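(* Let $\mathbb{D}=\{z\in\mathbb{C}:|z|<1\}$, let $h:\mathbb{D}\to\mathbb{C}$ be holomorphic with $h(0)=1$, and suppose that for all $z\in\mathbb{D}$ $$\log|h(z)|\le K\,\frac{|z|^{\gamma}}{(1-|z|)^{\alpha}}\prod_{j=1}^N\frac{1}{|z-\xi_j|^{\beta_j}},$$ where $|\xi_j|=1$ $(1\le j\le N)$, and the exponents $\alpha,\beta_j$ and $\gamma$ are nonnegative. Let $0<\tau<1$. Then the zeros of $h$ satisfy the inequality $$\sum_{z\in\mathbb{D},\,h(z)=0}\frac{(1-|z|)^{\alpha+1+\tau}}{|z|^{(\gamma-1+\tau)_+}}\prod_{j=1}^N|z-\xi_j|^{(\beta_j-1+\tau)_+}\le C(\alpha,\{\beta_j\},\gamma,\{\xi_j\},\tau)\,K,$$ where each zero is counted according to its multiplicity.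
   Context: For real $x$, $x_+=\max(x,0)$. $K$ is a constant, and $C(\alpha,\{\beta_j\},\gamma,\{\xi_j\},\tau)$ denotes a constant depending only on the indicated parameters. The convention $\log 0=-\infty$ is used.
   Formalization: The points ξ_1,…,ξ_N are taken to be pairwise distinct; without this the inequality fails, e.g. for ξ_1=ξ_2=1, β_1=β_2=1, α=γ=0, τ=1/4 and h(z)=sin((1-z)^{-2})/sin 1. *)

theory Defs
  imports "HOL-Complex_Analysis.Complex_Analysis"
begin

(* The library has ln 0 = 0; the convention log 0 = -infinity is needed here,
   so the logarithm takes values in the extended reals. *)
definition elog :: "real \<Rightarrow> ereal" where
  "elog x = (if x = 0 then -\<infinity> else ereal (ln x))"

(* At z = 0 with \<gamma> = 0 the library gives 0 powr 0 = 0 rather than 1.  The bound K * growth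
   at z = 0 is then 0, and log |h 0| = 0, so a hypothesis stated with this function only
   constrains h at z \<noteq> 0. *)
definition growth ::
  "real \<Rightarrow> (nat \<Rightarrow> real) \<Rightarrow> real \<Rightarrow> (nat \<Rightarrow> complex) \<Rightarrow> nat \<Rightarrow> complex \<Rightarrow> real" where
  "growth \<alpha> \<beta> \<gamma> \<xi> N z =
     norm z powr \<gamma> / (1 - norm z) powr \<alpha> * (\<Prod>j=1..N. 1 / norm (z - \<xi> j) powr \<beta> j)"

(* If h 0 = 1, no zero of h is at the origin, so all the bases below are positive at a zero
   in the open unit disk. *)
definition zero_weight ::
  "real \<Rightarrow> (nat \<Rightarrow> real) \<Rightarrow> real \<Rightarrow> (nat \<Rightarrow> complex) \<Rightarrow> nat \<Rightarrow> real \<Rightarrow> complex \<Rightarrow> real" where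
  "zero_weight \<alpha> \<beta> \<gamma> \<xi> N \<tau> z =
     (1 - norm z) powr (\<alpha> + 1 + \<tau>) / norm z powr max (\<gamma> - 1 + \<tau>) 0
       * (\<Prod>j=1..N. norm (z - \<xi> j) powr max (\<beta> j - 1 + \<tau>) 0)"

end

(* For finitely many zeros a of h in D, let Bl be the Blaschke product of the disc |z| < r at these
   zeros.  If g is holomorphic and Re g >= log|h/Bl| on the boundary of a domain Omega that lies in
   this disc and contains 0 and the zeros, the maximum principle for (h/Bl) exp(-g) gives
   sum log (r/|a|) <= Re g(0).
   Take Omega = {|z| < r, |z - xi_j| > rho_j} with r = 1 - delta, and zeros with
   |a - xi_j| >= M rho_j.  On the closure of Omega, log|h| is at most
   C K delta^(-alpha) prod rho_j^(-(beta_j-1+tau)_+) times 1 + sum |z - xi_j|^(-(1-tau)), and each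
   |z - xi_j|^(-(1-tau)) is dominated by the positive harmonic function
   Re (1 - z cnj xi_j)^(-(1-tau)).  On the arcs |z - xi_j| = rho_j, with T the sum of 1 - |a| over
   these zeros, -log|Bl| is O(T / (M^2 rho_j)); a Poisson kernel of width rho_j dominates this and
   costs only O(T / M^2) at the origin, so for large M it is absorbed in the left-hand side.
   The resulting bound on T is summed over dyadic ranges of 1 - |a| and |a - xi_j|: the factor
   (1 - |a|)^tau is geometrically small, against polynomially many ranges for each depth.  Near the
   origin, Jensen's formula on small discs bounds the number of zeros with |a| <= t by
   C K t^gamma. *)

theory Submission
  imports Defs
begin

section \<open>Jensen's inequality on a subdomain of a disc\<close>

lemma holomorphic_divide_power:
  assumes q: "q holomorphic_on S" and "open S" "open U" "a \<in> U" "U \<subseteq> S"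
    and g: "g holomorphic_on U" and eq: "\<And>w. w \<in> U \<Longrightarrow> q w = (w - a) ^ n * g w"
  obtains q' where "q' holomorphic_on S" "\<And>w. w \<in> S \<Longrightarrow> q w = (w - a) ^ n * q' w"
proof -
  \<comment> \<open>Gluing: off \<open>a\<close> the quotient is holomorphic, and on
    \<open>U\<close> the function \<open>g\<close> continues it across \<open>a\<close>; the two
    agree on the overlap.\<close>
  define q' where "q' w = (if w \<in> U then g w else q w / (w - a) ^ n)" for w
  have away: "q' w = q w / (w - a) ^ n" if "w \<in> S - {a}" for w
    using that eq by (auto simp: q'_def)
  have "q' holomorphic_on U"
    using g by (rule holomorphic_transform) (simp add: q'_def)
  moreover have "q' holomorphic_on S - {a}"
  proof (rule holomorphic_transform)
    show "(\<lambda>w. q w / (w - a) ^ n) holomorphic_on S - {a}"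
      by (intro holomorphic_intros holomorphic_on_subset[OF q]) auto
  qed (simp add: away)
  ultimately have "q' holomorphic_on U \<union> (S - {a})"
    using assms by (intro holomorphic_on_Un) auto
  moreover have "U \<union> (S - {a}) = S"
    using assms by auto
  moreover have "q w = (w - a) ^ n * q' w" if "w \<in> S" for w
    using that eq[of w] away[of w] \<open>a \<in> U\<close> by (cases "w \<in> U") (auto simp: q'_def)
  ultimately show ?thesis
    using that by metis
qed

text \<open>Induction on \<open>F\<close>: the earlier factors do not vanish near the new point
  \<open>a\<close>, so the quotient \<open>q\<close> they leave has the same order there as
  \<open>h\<close>. Its local factor is \<open>zor_poly h a\<close> divided by the earlier
  factors.\<close>

lemma holomorphic_factor_zeros:
  fixes h :: "complex \<Rightarrow> complex"
  assumes h: "h holomorphic_on S" and S: "open S" "connected S" "\<exists>w\<in>S. h w \<noteq> 0"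
    and "finite F" "F \<subseteq> S"
  shows "\<exists>q. q holomorphic_on S \<and>
           (\<forall>z\<in>S. h z = (\<Prod>a\<in>F. (z - a) ^ nat (zorder h a)) * q z)"
  using \<open>finite F\<close> \<open>F \<subseteq> S\<close>
proof (induction F rule: finite_induct)
  case empty
  then show ?case using h by auto
next
  case (insert a F)
  then obtain q where q: "q holomorphic_on S"
      and hq: "\<And>z. z \<in> S \<Longrightarrow> h z = (\<Prod>a\<in>F. (z - a) ^ nat (zorder h a)) * q z"
    by auto
  let ?P = "\<lambda>z. \<Prod>a\<in>F. (z - a) ^ nat (zorder h a)"
  obtain r where r: "r > 0" "cball a r \<subseteq> S" "zor_poly h a holomorphic_on cball a r"
      "\<And>w. w \<in> cball a r \<Longrightarrow> h w = zor_poly h a w * (w - a) ^ nat (zorder h a)"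
  proof -
    have "a \<in> S" using insert.prems by simp
    from zorder_exist_zero[OF h S(1,2) this S(3)] show ?thesis
      using that by blast
  qed
  have nz: "?P w \<noteq> 0" if "w \<notin> F" for w
    using that insert by auto
  obtain q' where q': "q' holomorphic_on S"
      "\<And>w. w \<in> S \<Longrightarrow> q w = (w - a) ^ nat (zorder h a) * q' w"
  proof (rule holomorphic_divide_power[OF q S(1), where U = "ball a r - F"])
    show "open (ball a r - F)"
      using insert by (simp add: finite_imp_closed open_Diff)
    show "(\<lambda>w. zor_poly h a w / ?P w) holomorphic_on ball a r - F"
      by (intro holomorphic_intros holomorphic_on_subset[OF r(3)]) (use nz in auto)
    fix w assume w: "w \<in> ball a r - F"
    then have "w \<in> S" "w \<in> cball a r" "w \<notin> F" using r(2) by auto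
    then have "?P w * q w = zor_poly h a w * (w - a) ^ nat (zorder h a)"
      using hq[of w] r(4)[of w] by simp
    then show "q w = (w - a) ^ nat (zorder h a) * (zor_poly h a w / ?P w)"
      using nz[OF \<open>w \<notin> F\<close>] by (simp add: field_simps)
  qed (use r insert in auto)
  show ?case
    using q' hq insert by (intro exI[of _ q']) (simp add: mult_ac)
qed

section \<open>Blaschke factors of the disc |z| < r and the maximum principle\<close>

lemma norm_blaschke_denominator:
  fixes a z :: complex
  shows "norm (of_real (r\<^sup>2) - cnj a * z) ^ 2
    = r\<^sup>2 * norm (z - a) ^ 2 + (r\<^sup>2 - norm a ^ 2) * (r\<^sup>2 - norm z ^ 2)"
  unfolding cmod_power2 by (simp add: algebra_simps power2_eq_square)

text \<open>The logarithm on the left is -log of the modulus of the Blaschke factor of |z| < r with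
  zero \<open>a\<close>. By \<open>norm_blaschke_denominator\<close> the squared quotient is 1 + x,
  and log(1 + x) <= x. The right side vanishes for |z| = r, so the estimate also settles the
  boundary circle.\<close>

lemma ln_inverse_blaschke_le:
  fixes a z :: complex
  assumes "0 < r" "norm a < r" "norm z \<le> r" "z \<noteq> a"
  shows "ln (norm (of_real (r\<^sup>2) - cnj a * z) / (r * norm (z - a)))
    \<le> (r\<^sup>2 - norm a ^ 2) * (r\<^sup>2 - norm z ^ 2) / (2 * r\<^sup>2 * norm (z - a) ^ 2)"
proof -
  let ?D = "norm (of_real (r\<^sup>2) - cnj a * z)" and ?E = "r * norm (z - a)"
  let ?x = "(r\<^sup>2 - norm a ^ 2) * (r\<^sup>2 - norm z ^ 2) / ?E ^ 2"
  have E: "?E > 0" using assms by simp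
  have x: "?x \<ge> 0"
    using assms by (intro divide_nonneg_nonneg mult_nonneg_nonneg) (auto simp: power_mono)
  have sq: "(?D / ?E) ^ 2 = 1 + ?x"
    using assms unfolding power_divide norm_blaschke_denominator
    by (simp add: power_mult_distrib add_divide_distrib)
  then have "?D / ?E \<noteq> 0"
    using x E by (intro notI) auto
  then have "?D / ?E > 0"
    using E by (simp add: zero_less_divide_iff)
  then have "ln (?D / ?E) * 2 = ln (1 + ?x)"
    unfolding sq[symmetric] by (subst ln_realpow) auto
  also have "\<dots> \<le> ?x" using ln_add_one_self_le_self[OF x] .
  finally have "ln (?D / ?E) \<le> ?x / 2" by (rule mult_imp_le_div_pos[rotated]) simp
  also have "?x / 2 = (r\<^sup>2 - norm a ^ 2) * (r\<^sup>2 - norm z ^ 2) / (2 * r\<^sup>2 * norm (z - a) ^ 2)"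
    by (simp add: power_mult_distrib mult_ac)
  finally show ?thesis .
qed

text \<open>Passing to a subdomain allows the boundary bound to stay away from the singular points
  on the unit circle. On frontier points with |z| < r the Blaschke product has modulus below 1, so
  there \<open>g\<close> must dominate its logarithm in addition to log|h|.\<close>

lemma jensen_inequality_domain:
  fixes h q g :: "complex \<Rightarrow> complex" and n :: "complex \<Rightarrow> nat"
  assumes q: "q holomorphic_on ball 0 1"
    and hq: "\<And>z. z \<in> ball 0 1 \<Longrightarrow> h z = (\<Prod>a\<in>F. (z - a) ^ n a) * q z"
    and "h 0 = 1" "finite F" and r: "0 < r" "r < 1"
    and \<Omega>: "open \<Omega>" "0 \<in> \<Omega>" "\<Omega> \<subseteq> ball 0 r" "F \<subseteq> \<Omega>" "0 \<notin> F"
    and g: "g holomorphic_on ball 0 1"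
    and bd: "\<And>z. z \<in> frontier \<Omega> \<Longrightarrow> h z \<noteq> 0 \<Longrightarrow>
        ln (norm (h z)) + (\<Sum>a\<in>F. n a * ln (norm (of_real (r\<^sup>2) - cnj a * z) / (r * norm (z - a))))
          \<le> Re (g z)"
  shows "(\<Sum>a\<in>F. n a * ln (r / norm a)) \<le> Re (g 0)"
proof -
  \<comment> \<open>This is (h / Bl) exp(-g), written with \<open>q\<close> so that it is
    holomorphic at the points of \<open>F\<close> too.\<close>
  define f where "f z = q z * (\<Prod>a\<in>F. ((of_real (r\<^sup>2) - cnj a * z) / r) ^ n a) * exp (- g z)" for z
  have "closure \<Omega> \<subseteq> closure (ball 0 r)"
    by (rule closure_mono) (rule \<Omega>)
  then have cl: "closure \<Omega> \<subseteq> cball 0 r" using r by simp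
  then have sub: "closure \<Omega> \<subseteq> ball 0 1" using r by auto
  have fhol: "f holomorphic_on ball 0 1"
    unfolding f_def by (intro holomorphic_intros q g) (use r in auto)
  have Fr: "norm a < r" if "a \<in> F" for a using that \<Omega> by (auto simp: subset_iff)
  have pos: "norm (of_real (r\<^sup>2) - cnj a * z) > 0" if "a \<in> F" "norm z \<le> r" for a z
  proof -
    have "norm (cnj a * z) < r * r"
    proof (cases "z = 0")
      case False
      then have "norm a * norm z < r * norm z"
        using Fr[OF that(1)] by (intro mult_strict_right_mono) auto
      also have "\<dots> \<le> r * r" using that(2) r by (intro mult_left_mono) auto
      finally show ?thesis by (simp add: norm_mult)
    qed (use r in auto)
    moreover have "norm (of_real (r\<^sup>2) :: complex) = r * r"
      by (simp add: power2_eq_square norm_mult)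
    ultimately show ?thesis
      using norm_triangle_ineq2[of "of_real (r\<^sup>2)" "cnj a * z"] by linarith
  qed
  have val: "norm (f z) = exp (ln (norm (h z)) + (\<Sum>a\<in>F. n a * ln (norm (of_real (r\<^sup>2) - cnj a * z) / (r * norm (z - a)))) - Re (g z))"
    if z: "norm z \<le> r" "h z \<noteq> 0" "z \<notin> F" for z
  proof -
    have *: "exp (n a * ln (norm (of_real (r\<^sup>2) - cnj a * z) / (r * norm (z - a))))
       = norm ((of_real (r\<^sup>2) - cnj a * z) / r) ^ n a / norm (z - a) ^ n a" if "a \<in> F" for a
    proof -
      have "norm (z - a) > 0" using z that by auto
      then have "norm (of_real (r\<^sup>2) - cnj a * z) / (r * norm (z - a)) > 0"
        using pos[OF that z(1)] r by (intro divide_pos_pos mult_pos_pos) auto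
      then show ?thesis
        using r by (simp add: exp_of_nat_mult power_divide norm_divide power_mult_distrib)
    qed
    have "h z = (\<Prod>a\<in>F. (z - a) ^ n a) * q z" using z r by (intro hq) auto
    then have "norm (h z) = (\<Prod>a\<in>F. norm (z - a) ^ n a) * norm (q z)"
      by (simp add: norm_mult norm_power flip: prod_norm)
    moreover have "(\<Prod>a\<in>F. norm (z - a) ^ n a) \<noteq> 0"
      using z \<open>finite F\<close> by auto
    moreover have "norm (f z) = norm (q z)
        * (\<Prod>a\<in>F. norm ((of_real (r\<^sup>2) - cnj a * z) / r) ^ n a) * exp (- Re (g z))"
      by (simp only: f_def norm_mult norm_exp_eq_Re norm_power uminus_complex.sel flip: prod_norm)
    moreover have "exp (\<Sum>a\<in>F. n a * ln (norm (of_real (r\<^sup>2) - cnj a * z) / (r * norm (z - a))))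
       = (\<Prod>a\<in>F. norm ((of_real (r\<^sup>2) - cnj a * z) / r) ^ n a) / (\<Prod>a\<in>F. norm (z - a) ^ n a)"
      unfolding exp_sum[OF \<open>finite F\<close>] prod_dividef[symmetric] by (rule prod.cong[OF refl *])
    moreover have "exp (ln (norm (h z))) = norm (h z)" using z by simp
    ultimately show ?thesis
      unfolding exp_diff exp_add exp_minus by (simp add: divide_inverse mult_ac)
  qed
  have "norm (f 0) \<le> 1"
  proof (rule maximum_modulus_frontier[of f \<Omega>])
    show "f holomorphic_on interior \<Omega>"
      using sub interior_subset closure_subset by (intro holomorphic_on_subset[OF fhol]) blast
    show "continuous_on (closure \<Omega>) f"
      using sub fhol holomorphic_on_imp_continuous_on continuous_on_subset by blast
    show "bounded \<Omega>" using \<Omega> bounded_ball bounded_subset by blast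
    show "0 \<in> \<Omega>" by fact
    fix z assume z: "z \<in> frontier \<Omega>"
    then have "z \<notin> \<Omega>" "norm z \<le> r" using \<Omega>(1) cl by (auto simp: frontier_def interior_open)
    show "norm (f z) \<le> 1"
    \<comment> \<open>The bound \<open>bd\<close> is silent at zeros of \<open>h\<close>. A frontier
      point is not in \<open>F\<close>, so such a zero is a zero of \<open>q\<close>, and
      \<open>f\<close> vanishes there.\<close>
    proof (cases "h z = 0")
      case True
      have "(\<Prod>a\<in>F. (z - a) ^ n a) \<noteq> 0"
        using \<open>z \<notin> \<Omega>\<close> \<Omega> \<open>finite F\<close> by auto
      then have "q z = 0" using True hq[of z] \<open>norm z \<le> r\<close> r by auto
      then show ?thesis by (simp add: f_def)
    next
      case False
      have "z \<notin> F" using \<open>z \<notin> \<Omega>\<close> \<Omega> by blast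
      show ?thesis unfolding val[OF \<open>norm z \<le> r\<close> False \<open>z \<notin> F\<close>]
        using bd[OF z False] by simp
    qed
  qed
  \<comment> \<open>At the origin each inverse Blaschke factor has modulus r / |a|, and log|h 0| =
    0.\<close>
  moreover have "norm (f 0) = exp ((\<Sum>a\<in>F. n a * ln (r / norm a)) - Re (g 0))"
    using val[of 0] \<Omega> r \<open>h 0 = 1\<close> by (simp add: power2_eq_square norm_mult)
  ultimately show ?thesis by simp
qed

section \<open>Zeros close to the unit circle\<close>

lemma cos_fraction_half_pi_pos:
  assumes "0 < s" "s < 1"
  shows "0 < cos (s * pi / 2)"
proof -
  have "s * (pi / 2) < 1 * (pi / 2)" using assms by (intro mult_strict_right_mono) auto
  moreover have "0 < s * (pi / 2)" using assms by (intro mult_pos_pos) auto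
  ultimately show ?thesis by (intro cos_gt_zero) auto
qed

text \<open>The argument of w is at most pi/2 in modulus, so that of w^(-s) is at most s pi/2 <
  pi/2. Thus |w|^(-s) has a harmonic majorant, up to the factor 1 / cos(s pi/2), exactly because s <
  1.\<close>

lemma Re_powr_minus_ge:
  fixes w :: complex
  assumes "Re w > 0" "0 < s" "s < 1"
  shows "cos (s * pi / 2) * norm w powr (- s) \<le> Re (w powr of_real (- s))"
proof -
  have w: "w \<noteq> 0" using assms by auto
  have "\<bar>Im (Ln w)\<bar> \<le> pi / 2" using Re_Ln_pos_lt_imp[OF assms(1)] by simp
  then have "s * \<bar>Im (Ln w)\<bar> \<le> s * (pi / 2)" using assms by (intro mult_left_mono) auto
  moreover have "s * (pi / 2) \<le> 1 * (pi / 2)" using assms by (intro mult_right_mono) auto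
  ultimately have "cos (s * pi / 2) \<le> cos (s * \<bar>Im (Ln w)\<bar>)"
    using assms pi_gt_zero by (intro cos_monotone_0_pi_le) (auto simp: field_simps)
  also have "\<dots> = cos \<bar>s * Im (Ln w)\<bar>" using assms by (simp add: abs_mult)
  also have "\<dots> = cos (s * Im (Ln w))" by (rule cos_abs_real)
  finally have "cos (s * pi / 2) \<le> cos (s * Im (Ln w))" .
  then have "cos (s * pi / 2) * norm w powr (- s) \<le> cos (s * Im (Ln w)) * norm w powr (- s)"
    by (intro mult_right_mono) auto
  also have "\<dots> = Re (w powr of_real (- s))"
    using w by (simp add: powr_def Re_exp)
  finally show ?thesis .
qed

text \<open>The real part is the Poisson kernel of the disc of radius 1 + t with pole at 1 + t. Its
  value at w = 0 is 1 for every t, while within distance t of the point 1 it is of order 1/t: a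
  large bound on a small arc at bounded cost at the origin.\<close>

lemma Re_poisson:
  fixes w :: complex and t :: real
  assumes "norm w < 1" "0 < t"
  shows Re_poisson_nonneg: "Re ((1 + of_real t + w) / (1 + of_real t - w)) \<ge> 0"
    and Re_poisson_ge: "norm (1 - w) \<le> t \<Longrightarrow> Re ((1 + of_real t + w) / (1 + of_real t - w)) \<ge> 1 / (2 * t)"
proof -
  let ?y = "1 + of_real t - w"
  have "Re ((1 + of_real t + w) / ?y) = Re ((1 + of_real t + w) * cnj ?y) / (norm ?y)\<^sup>2"
    by (metis Re_complex_div_eq_0 Re_divide_of_real complex_div_cnj of_real_power)
  also have "Re ((1 + of_real t + w) * cnj ?y) = (1 + t)\<^sup>2 - (norm w)\<^sup>2"
    unfolding cmod_power2 by (simp add: algebra_simps power2_eq_square)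
  finally have eq: "Re ((1 + of_real t + w) / ?y) = ((1 + t)\<^sup>2 - (norm w)\<^sup>2) / (norm ?y)\<^sup>2" .
  have "(norm w)\<^sup>2 \<le> 1" using assms by (simp add: power_le_one)
  then have num: "(1 + t)\<^sup>2 - (norm w)\<^sup>2 \<ge> 2 * t"
    unfolding power2_sum one_power2 using zero_le_power2[of t] by linarith
  then show "Re ((1 + of_real t + w) / ?y) \<ge> 0"
    unfolding eq using assms by (intro divide_nonneg_nonneg) auto
  assume *: "norm (1 - w) \<le> t"
  have "Re ?y > 0" using assms complex_Re_le_cmod[of w] by simp
  then have pos: "norm ?y > 0" by (auto simp del: norm_le_zero_iff)
  have "norm ?y \<le> norm (1 - w) + norm (of_real t :: complex)"
    using norm_triangle_ineq[of "1 - w" "of_real t"] by (simp add: algebra_simps)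
  then have "norm ?y \<le> 2 * t" using * assms by simp
  then have "(norm ?y)\<^sup>2 \<le> (2 * t)\<^sup>2" by (intro power_mono) auto
  then have "(2 * t) / (2 * t)\<^sup>2 \<le> ((1 + t)\<^sup>2 - (norm w)\<^sup>2) / (norm ?y)\<^sup>2"
    using pos num assms by (intro frac_le) auto
  then show "Re ((1 + of_real t + w) / ?y) \<ge> 1 / (2 * t)"
    unfolding eq using assms by (simp add: power2_eq_square)
qed

section \<open>Replacing the product of singularities by a sum\<close>

lemma prod_le_power_card_mult_sum:
  fixes x :: "'a \<Rightarrow> real"
  assumes "finite J" "\<And>j. j \<in> J \<Longrightarrow> x j \<ge> 0" "e \<ge> 1"
    and one: "\<And>i j. i \<in> J \<Longrightarrow> j \<in> J \<Longrightarrow> x i > e \<Longrightarrow> x j > e \<Longrightarrow> i = j"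
  shows "prod x J \<le> e ^ card J * (1 + sum x J)"
\<comment> \<open>By \<open>one\<close>, a single factor at most exceeds \<open>e\<close>; it is
  kept and bounded by the sum, the others are bounded by \<open>e\<close>.\<close>
proof (cases "\<exists>i\<in>J. x i > e")
  case True
  then obtain i where i: "i \<in> J" "x i > e" by auto
  have "prod x (J - {i}) \<le> (\<Prod>j\<in>J - {i}. e)"
    using assms i by (intro prod_mono) force
  also have "\<dots> \<le> e ^ card J"
    using assms by (auto intro!: power_increasing card_mono)
  finally have "x i * prod x (J - {i}) \<le> x i * e ^ card J"
    using assms i by (intro mult_left_mono) auto
  also have "\<dots> \<le> (1 + sum x J) * e ^ card J"
    using assms i member_le_sum[of i J x] by (intro mult_right_mono) auto
  finally show ?thesis
    using prod.remove[OF assms(1) i(1), of x] by (simp add: mult_ac)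
next
  case False
  then have "prod x J \<le> (\<Prod>j\<in>J. e)"
    using assms by (intro prod_mono) force
  also have "\<dots> = e ^ card J * 1" by simp
  also have "\<dots> \<le> e ^ card J * (1 + sum x J)"
    using assms by (intro mult_left_mono) (auto simp: sum_nonneg)
  finally show ?thesis .
qed

text \<open>Of the exponent \<beta> only 1 - \<tau> is left on t, an exponent below 1 as
  \<open>Re_powr_minus_ge\<close> requires. The rest is \<beta> - 1 + \<tau>: if nonnegative, t is
  replaced by the smaller u; if negative, it is above -1 and t <= 2 costs a factor 2 at
  most.\<close>

lemma powr_minus_le_split:
  fixes t u :: real
  assumes "0 < u" "u \<le> t" "t \<le> 2" "0 \<le> \<beta>" "0 < \<tau>"
  shows "t powr (- \<beta>) \<le> 2 * u powr (- max (\<beta> - 1 + \<tau>) 0) * t powr (- (1 - \<tau>))"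
proof -
  let ?e = "\<beta> - 1 + \<tau>"
  have "t powr (- ?e) \<le> 2 * u powr (- max ?e 0)"
  proof (cases "?e \<ge> 0")
    case True
    then have "t powr (- ?e) \<le> u powr (- ?e)"
      using assms by (intro powr_mono2') auto
    also have "\<dots> \<le> 2 * u powr (- ?e)" by simp
    finally show ?thesis using True by simp
  next
    case False
    then have "t powr (- ?e) \<le> 2 powr (- ?e)"
      using assms by (intro powr_mono2) auto
    also have "\<dots> \<le> 2 powr 1" using assms by (intro powr_mono) auto
    finally show ?thesis using False assms by simp
  qed
  then have "t powr (- ?e) * t powr (- (1 - \<tau>)) \<le> 2 * u powr (- max ?e 0) * t powr (- (1 - \<tau>))"
    by (intro mult_right_mono) auto
  moreover have "t powr (- ?e) * t powr (- (1 - \<tau>)) = t powr (- \<beta>)"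
    by (simp flip: powr_add)
  ultimately show ?thesis by simp
qed

text \<open>Each singular factor is split by \<open>powr_minus_le_split\<close>. Since the points
  \<xi> are 2d apart, z is within d of at most one of them, so at most one of the remaining powers
  is above \<open>d powr (- (1 - \<tau>))\<close> and the product turns into a sum of terms with
  harmonic majorants.\<close>

lemma growth_le:
  assumes \<alpha>: "\<alpha> \<ge> 0" "\<gamma> \<ge> 0" and \<beta>: "\<And>j. j \<in> {1..N} \<Longrightarrow> \<beta> j \<ge> 0"
    and \<xi>: "\<And>j. j \<in> {1..N} \<Longrightarrow> norm (\<xi> j) = 1"
    and \<tau>: "0 < \<tau>" "\<tau> < 1"
    and d: "0 < d" "d \<le> 1"
      "\<And>i j. i \<in> {1..N} \<Longrightarrow> j \<in> {1..N} \<Longrightarrow> i \<noteq> j \<Longrightarrow> 2 * d \<le> norm (\<xi> i - \<xi> j)"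
    and z: "0 < \<delta>" "norm z \<le> 1 - \<delta>"
      "\<And>j. j \<in> {1..N} \<Longrightarrow> 0 < \<rho> j \<and> \<rho> j \<le> norm (z - \<xi> j)"
  shows "growth \<alpha> \<beta> \<gamma> \<xi> N z \<le> (2 * d powr (- (1 - \<tau>))) ^ N * \<delta> powr (- \<alpha>)
     * (\<Prod>j=1..N. \<rho> j powr (- max (\<beta> j - 1 + \<tau>) 0))
     * (1 + (\<Sum>j=1..N. norm (z - \<xi> j) powr (- (1 - \<tau>))))"
proof -
  let ?t = "\<lambda>j. norm (z - \<xi> j)" and ?e = "d powr (- (1 - \<tau>))"
  let ?x = "\<lambda>j. ?t j powr (- (1 - \<tau>))"
  let ?R = "\<lambda>j. \<rho> j powr (- max (\<beta> j - 1 + \<tau>) 0)"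
  have z1: "norm z < 1" using z by simp
  have t2: "?t j \<le> 2" if "j \<in> {1..N}" for j
    using norm_triangle_ineq4[of z "\<xi> j"] z1 \<xi>[OF that] by simp
  have e: "?e \<ge> 1"
    using powr_mono2'[of "- (1 - \<tau>)" d 1] d \<tau> by simp
  have "(\<Prod>j=1..N. 1 / ?t j powr \<beta> j) \<le> (\<Prod>j=1..N. 2 * ?R j * ?x j)"
  proof (intro prod_mono conjI)
    fix j assume j: "j \<in> {1..N}"
    have "1 / ?t j powr \<beta> j = ?t j powr (- \<beta> j)" by (simp add: powr_minus_divide)
    also have "\<dots> \<le> 2 * ?R j * ?x j"
      using z(3)[OF j] t2[OF j] \<beta>[OF j] \<tau> by (intro powr_minus_le_split) auto
    finally show "1 / ?t j powr \<beta> j \<le> 2 * ?R j * ?x j" .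
  qed auto
  also have "\<dots> = 2 ^ N * prod ?R {1..N} * prod ?x {1..N}"
    by (simp add: prod.distrib)
  also have "\<dots> \<le> 2 ^ N * prod ?R {1..N} * (?e ^ card {1..N} * (1 + sum ?x {1..N}))"
  proof (intro mult_left_mono prod_le_power_card_mult_sum)
    fix i j assume ij: "i \<in> {1..N}" "j \<in> {1..N}" "?x i > ?e" "?x j > ?e"
    have close: "?t k < d" if "k \<in> {1..N}" "?x k > ?e" for k
    proof (rule ccontr)
      assume "\<not> ?t k < d"
      then have "?x k \<le> ?e" using d \<tau> by (intro powr_mono2') auto
      then show False using that by simp
    qed
    show "i = j"
    proof (rule ccontr)
      assume "i \<noteq> j"
      have "norm (\<xi> i - \<xi> j) \<le> ?t i + ?t j"
        using norm_triangle_ineq4[of "z - \<xi> j" "z - \<xi> i"] by simp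
      then show False using close[OF ij(1,3)] close[OF ij(2,4)] d(3)[OF ij(1,2) \<open>i \<noteq> j\<close>] by simp
    qed
  qed (use e in \<open>auto intro!: mult_nonneg_nonneg prod_nonneg\<close>)
  also have "\<dots> = (2 * ?e) ^ N * prod ?R {1..N} * (1 + sum ?x {1..N})"
    by (simp add: power_mult_distrib mult_ac)
  finally have P: "(\<Prod>j=1..N. 1 / ?t j powr \<beta> j) \<le> \<dots>" .
  have "norm z powr \<gamma> / (1 - norm z) powr \<alpha> \<le> 1 * \<delta> powr (- \<alpha>)"
    unfolding divide_inverse powr_minus[symmetric]
    using z z1 \<alpha> by (intro mult_mono powr_mono2' powr_le1) auto
  then have "growth \<alpha> \<beta> \<gamma> \<xi> N z \<le>
      (1 * \<delta> powr (- \<alpha>)) * ((2 * ?e) ^ N * prod ?R {1..N} * (1 + sum ?x {1..N}))"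
    unfolding growth_def using P by (intro mult_mono) (auto intro!: prod_nonneg)
  then show ?thesis by (simp add: mult_ac)
qed

text \<open>Both differences of squares are at most twice the distance to the unit circle, and r >=
  1/2 gives 2 r^2 >= 1/2; hence 8 = 2 * 2 / (1/2), uniformly in r.\<close>

lemma ln_inverse_blaschke_le_depth:
  fixes a z :: complex
  assumes "1 / 2 \<le> r" "r \<le> 1" "norm a < r" "norm z \<le> r" "z \<noteq> a"
  shows "ln (norm (of_real (r\<^sup>2) - cnj a * z) / (r * norm (z - a)))
    \<le> 8 * (1 - norm a) * (1 - norm z) / norm (z - a) ^ 2"
proof -
  have le: "r\<^sup>2 - norm u ^ 2 \<le> 2 * (1 - norm u)" if "norm u \<le> r" for u :: complex
  proof -
    have "r\<^sup>2 \<le> 1" using assms by (simp add: power_le_one)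
    then have "r\<^sup>2 - norm u ^ 2 \<le> (1 + norm u) * (1 - norm u)"
      by (simp add: algebra_simps power2_eq_square)
    also have "\<dots> \<le> 2 * (1 - norm u)"
      using that assms by (intro mult_right_mono) auto
    finally show ?thesis .
  qed
  have ge: "r\<^sup>2 - norm u ^ 2 \<ge> 0" if "norm u \<le> r" for u :: complex
    using that by (simp add: power_mono)
  have "(1 / 2)\<^sup>2 \<le> r\<^sup>2" using assms by (intro power_mono) auto
  then have r4: "1 / 2 \<le> 2 * r\<^sup>2" by (simp add: power2_eq_square)
  have "ln (norm (of_real (r\<^sup>2) - cnj a * z) / (r * norm (z - a)))
    \<le> (r\<^sup>2 - norm a ^ 2) * (r\<^sup>2 - norm z ^ 2) / (2 * r\<^sup>2 * norm (z - a) ^ 2)"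
    using assms by (intro ln_inverse_blaschke_le) auto
  also have "\<dots> \<le> (2 * (1 - norm a)) * (2 * (1 - norm z)) / (1 / 2 * norm (z - a) ^ 2)"
  proof (rule frac_le)
    show "(r\<^sup>2 - norm a ^ 2) * (r\<^sup>2 - norm z ^ 2) \<le> (2 * (1 - norm a)) * (2 * (1 - norm z))"
      using assms by (intro mult_mono le ge) auto
    show "1 / 2 * norm (z - a) ^ 2 \<le> 2 * r\<^sup>2 * norm (z - a) ^ 2"
      using r4 by (intro mult_right_mono) auto
  qed (use assms in auto)
  also have "(2 * p) * (2 * q) / (1 / 2 * D) = 8 * p * q / D" for p q D :: real
    by simp
  finally show ?thesis .
qed

lemma ln_norm_le_of_elog_le:
  assumes "elog (norm w) \<le> ereal c" "w \<noteq> 0"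
  shows "ln (norm w) \<le> c"
  using assms by (simp add: elog_def)

lemma ln_ratio_ge:
  fixes x r :: real
  assumes "0 < x" "x < r" "r \<le> 1"
  shows "r - x \<le> ln (r / x)"
proof -
  have "ln (x / r) \<le> x / r - 1" using assms by (intro ln_le_minus_one) auto
  moreover have "ln (r / x) = - ln (x / r)" using assms by (simp add: ln_div)
  moreover have "r - x \<le> (r - x) / r" using assms
    mult_left_le[of r "r - x"] by (simp add: le_divide_eq)
  moreover have "(r - x) / r = 1 - x / r" using assms by (simp add: field_simps)
  ultimately show ?thesis by linarith
qed

text \<open>The separation factor M = 1 + 8 (N + 1) is chosen for absorption: with T the sum on the
  left, Jensen's inequality yields at least T/2, while compensating the Blaschke product on the arcs
  costs at most T/4 at the origin.\<close>

lemma zeros_depth_sum_le: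
  fixes h :: "complex \<Rightarrow> complex" and \<xi> :: "nat \<Rightarrow> complex"
  assumes \<alpha>: "\<alpha> \<ge> 0" "\<gamma> \<ge> 0" and \<beta>: "\<And>j. j \<in> {1..N} \<Longrightarrow> \<beta> j \<ge> 0"
    and \<xi>: "\<And>j. j \<in> {1..N} \<Longrightarrow> norm (\<xi> j) = 1"
    and \<tau>: "0 < \<tau>" "\<tau> < 1"
    and d: "0 < d" "d \<le> 1"
      "\<And>i j. i \<in> {1..N} \<Longrightarrow> j \<in> {1..N} \<Longrightarrow> i \<noteq> j \<Longrightarrow> 2 * d \<le> norm (\<xi> i - \<xi> j)"
    and K: "K \<ge> 0" and h: "h holomorphic_on ball 0 1" "h 0 = 1"
    and bd: "\<And>z. z \<in> ball 0 1 \<Longrightarrow> elog (norm (h z)) \<le> ereal (K * growth \<alpha> \<beta> \<gamma> \<xi> N z)"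
    and F: "finite F" "F \<subseteq> {z \<in> ball 0 1. h z = 0}"
    and \<delta>: "0 < \<delta>" "\<delta> \<le> 1 / 4" "\<And>a. a \<in> F \<Longrightarrow> 2 * \<delta> \<le> 1 - norm a"
    and \<rho>: "\<And>j. j \<in> {1..N} \<Longrightarrow> 0 < \<rho> j" "\<And>j. j \<in> {1..N} \<Longrightarrow> \<rho> j < 1"
      "\<And>a j. a \<in> F \<Longrightarrow> j \<in> {1..N} \<Longrightarrow> (1 + 8 * (real N + 1)) * \<rho> j \<le> norm (a - \<xi> j)"
  shows "(\<Sum>a\<in>F. nat (zorder h a) * (1 - norm a)) \<le>
    4 * (real N + 1) * ((2 * d powr (- (1 - \<tau>))) ^ N / cos ((1 - \<tau>) * pi / 2)) * K
      * \<delta> powr (- \<alpha>) * (\<Prod>j=1..N. \<rho> j powr (- max (\<beta> j - 1 + \<tau>) 0))"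
proof -
  let ?n = "\<lambda>a. nat (zorder h a)"
  define r where "r = 1 - \<delta>"
  define T where "T = (\<Sum>a\<in>F. ?n a * (1 - norm a))"
  \<comment> \<open>With this c, the kernel bound c / (2 \<rho>) equals T / (8 (N+1)^2 \<rho>), the
    bound found below for -log|Bl| on an arc of radius \<rho>.\<close>
  define c where "c = T / (4 * (real N + 1)\<^sup>2)"
  define \<kappa> where "\<kappa> = cos ((1 - \<tau>) * pi / 2)"
  define D where "D = (2 * d powr (- (1 - \<tau>))) ^ N"
  define A where "A = D / \<kappa> * \<delta> powr (- \<alpha>) * (\<Prod>j=1..N. \<rho> j powr (- max (\<beta> j - 1 + \<tau>) 0))"
  define \<Omega> where "\<Omega> = ball 0 r \<inter> (\<Inter>j\<in>{1..N}. - cball (\<xi> j) (\<rho> j))"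
  let ?w = "\<lambda>j z. z * cnj (\<xi> j)"
  let ?P = "\<lambda>j z. (1 + of_real (\<rho> j) + ?w j z) / (1 + of_real (\<rho> j) - ?w j z)"
  \<comment> \<open>The first summand is to dominate log|h|, the Poisson kernels -log|Bl|.\<close>
  define g where "g z = of_real (K * A) * (1 + (\<Sum>j=1..N. (1 - ?w j z) powr of_real (- (1 - \<tau>))))
      + of_real c * (\<Sum>j=1..N. ?P j z)" for z
  have r: "1 / 2 \<le> r" "r < 1" using \<delta> by (auto simp: r_def)
  have \<kappa>: "0 < \<kappa>" "\<kappa> \<le> 1"
    using cos_fraction_half_pi_pos[of "1 - \<tau>"] \<tau> by (auto simp: \<kappa>_def)
  have D: "D > 0" using d by (simp add: D_def)
  have A: "A \<ge> 0" using D \<kappa> unfolding A_def by (intro mult_nonneg_nonneg prod_nonneg) auto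
  have Fa: "norm a < 1" "norm a < r" "h a = 0" if "a \<in> F" for a
    using that F(2) \<delta>(1) \<delta>(3)[OF that] by (auto simp: r_def)
  have T: "T \<ge> 0" unfolding T_def using Fa(1) by (intro sum_nonneg mult_nonneg_nonneg) (auto simp: less_imp_le)
  then have c: "c \<ge> 0" unfolding c_def by (intro divide_nonneg_nonneg) auto
  have w1: "norm (?w j z) < 1" "norm (1 - ?w j z) = norm (z - \<xi> j)"
    if "j \<in> {1..N}" "norm z < 1" for j z
  proof -
    show "norm (?w j z) < 1" using that \<xi>[of j] by (simp add: norm_mult)
    have "\<xi> j * cnj (\<xi> j) = 1"
      using \<xi>[OF that(1)] by (simp add: complex_norm_square[symmetric])
    \<comment> \<open>Rotation by the unimodular \<open>\<xi> j\<close> moves the singular point to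
      1, where powers and kernels have their standard form.\<close>
    then have "1 - ?w j z = (\<xi> j - z) * cnj (\<xi> j)" by (simp add: algebra_simps)
    then show "norm (1 - ?w j z) = norm (z - \<xi> j)"
      using \<xi>[OF that(1)] by (simp add: norm_mult norm_minus_commute)
  qed
  have Rew: "Re (1 - ?w j z) > 0" if "j \<in> {1..N}" "norm z < 1" for j z
    using w1(1)[OF that] complex_Re_le_cmod[of "?w j z"] by simp
  have ghol: "g holomorphic_on ball 0 1"
    unfolding g_def
  proof (intro holomorphic_intros)
    fix j z assume jz: "j \<in> {1..N}" "z \<in> ball (0::complex) 1"
    have "Re (1 - ?w j z) > 0" using Rew jz by simp
    then show "1 - ?w j z \<notin> \<real>\<^sub>\<le>\<^sub>0" by (auto simp: complex_nonpos_Reals_iff)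
    have "Re (1 + of_real (\<rho> j) - ?w j z) > 0"
      using \<open>Re (1 - ?w j z) > 0\<close> \<rho>(1)[OF jz(1)] by simp
    then show "1 + of_real (\<rho> j) - ?w j z \<noteq> 0" by force
  qed
  have Pnn: "0 \<le> Re (?P j z)" if "j \<in> {1..N}" "norm z < 1" for j z
    using Re_poisson_nonneg[OF w1(1)[OF that] \<rho>(1)[OF that(1)]] .
  obtain q where q: "q holomorphic_on ball 0 1"
      "\<And>z. z \<in> ball 0 1 \<Longrightarrow> h z = (\<Prod>a\<in>F. (z - a) ^ ?n a) * q z"
    using holomorphic_factor_zeros[OF h(1) open_ball connected_ball _ F(1)] h(2) F(2)
    by (smt (verit, ccfv_threshold) centre_in_ball mem_Collect_eq subset_iff zero_neq_one)
  have "(\<Sum>a\<in>F. ?n a * ln (r / norm a)) \<le> Re (g 0)"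
  proof (rule jensen_inequality_domain[OF q h(2) F(1)])
    show "0 < r" "r < 1" using r by auto
    show op: "open \<Omega>" unfolding \<Omega>_def by (intro open_Int open_INT) auto
    \<comment> \<open>The excised discs are centred on the unit circle with radii below 1, so they
      miss the origin.\<close>
    show "0 \<in> \<Omega>" using r \<xi> \<rho>(2) by (fastforce simp: \<Omega>_def dist_norm)
    show "\<Omega> \<subseteq> ball 0 r" by (auto simp: \<Omega>_def)
    show "F \<subseteq> \<Omega>"
    proof
      fix a assume a: "a \<in> F"
      have "a \<notin> cball (\<xi> j) (\<rho> j)" if j: "j \<in> {1..N}" for j
      proof -
        have "1 * \<rho> j < (1 + 8 * (real N + 1)) * \<rho> j"
          using \<rho>(1)[OF j] by (intro mult_strict_right_mono) auto
        then show ?thesis using \<rho>(3)[OF a j] by (simp add: dist_norm norm_minus_commute)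
      qed
      then show "a \<in> \<Omega>" using Fa[OF a] by (auto simp: \<Omega>_def)
    qed
    show "0 \<notin> F" using Fa(3) h(2) by force
    show "g holomorphic_on ball 0 1" by fact
    fix z assume z: "z \<in> frontier \<Omega>" "h z \<noteq> 0"
    let ?C = "cball 0 r \<inter> (\<Inter>j\<in>{1..N}. - ball (\<xi> j) (\<rho> j))"
    \<comment> \<open>The larger closed set \<open>?C\<close> keeps the lower bound \<rho> on the
      distances to the points \<xi> valid on the frontier.\<close>
    have "closed ?C" by (intro closed_Int closed_INT) auto
    moreover have "\<Omega> \<subseteq> ?C" unfolding \<Omega>_def by (intro Int_mono INF_mono) force+
    ultimately have "closure \<Omega> \<subseteq> ?C" by (rule closure_minimal[rotated])
    then have zC: "z \<in> ?C" using z(1) by (auto simp: frontier_def)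
    have zn: "z \<notin> \<Omega>" using z(1) op by (auto simp: frontier_def interior_open)
    have zr: "norm z \<le> r" using zC by simp
    then have z1: "norm z < 1" using r by simp
    have z\<rho>: "\<rho> j \<le> norm (z - \<xi> j)" if "j \<in> {1..N}" for j
      using zC that by (auto simp: dist_norm norm_minus_commute not_less)
    have zF: "z \<noteq> a" if "a \<in> F" for a using that z(2) Fa(3) by auto
    let ?S = "\<Sum>a\<in>F. ?n a * ln (norm (of_real (r\<^sup>2) - cnj a * z) / (r * norm (z - a)))"
    have PS: "(\<Sum>j=1..N. Re (?P j z)) \<ge> 0" by (intro sum_nonneg Pnn) (auto simp: z1)
    have "?S \<le> c * (\<Sum>j=1..N. Re (?P j z))"
    \<comment> \<open>On the outer circle the Blaschke product has modulus 1; any other frontier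
      point lies on an arc around some \<open>\<xi> j\<close>.\<close>
    proof (cases "norm z = r")
      case True
      have "?S \<le> 0"
      proof (intro sum_nonpos mult_nonneg_nonpos)
        fix a assume "a \<in> F"
        then show "ln (norm (of_real (r\<^sup>2) - cnj a * z) / (r * norm (z - a))) \<le> 0"
          using ln_inverse_blaschke_le[of r a z] Fa zF r True by auto
      qed auto
      moreover have "0 \<le> c * (\<Sum>j=1..N. Re (?P j z))" by (intro mult_nonneg_nonneg c PS)
      ultimately show ?thesis by linarith
    next
      case False
      then obtain j where j: "j \<in> {1..N}" "norm (z - \<xi> j) \<le> \<rho> j"
        using zn zr by (auto simp: \<Omega>_def dist_norm norm_minus_commute)
      have \<rho>j: "\<rho> j > 0" using \<rho>(1) j by simp
      have "1 \<le> norm (z - \<xi> j) + norm z"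
        using norm_triangle_ineq4[of z "z - \<xi> j"] \<xi>[OF j(1)] by simp
      then have zd: "1 - norm z \<le> \<rho> j" using j by simp
      have "?S \<le> (\<Sum>a\<in>F. ?n a * ((1 - norm a) * (1 / (8 * (real N + 1)\<^sup>2 * \<rho> j))))"
      proof (intro sum_mono mult_left_mono)
        fix a assume a: "a \<in> F"
        have "norm (a - \<xi> j) \<le> norm (z - a) + norm (z - \<xi> j)"
          using norm_triangle_ineq4[of "z - \<xi> j" "z - a"] by simp
        \<comment> \<open>Here the summand 1 in M pays for the distance from z to
          \<open>\<xi> j\<close>.\<close>
        then have za: "8 * (real N + 1) * \<rho> j \<le> norm (z - a)"
          using \<rho>(3)[OF a j(1)] j(2) by (simp add: algebra_simps)
        have "ln (norm (of_real (r\<^sup>2) - cnj a * z) / (r * norm (z - a)))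
            \<le> 8 * (1 - norm a) * (1 - norm z) / norm (z - a) ^ 2"
          using Fa[OF a] zF[OF a] zr r by (intro ln_inverse_blaschke_le_depth) auto
        also have "\<dots> \<le> 8 * (1 - norm a) * \<rho> j / (8 * (real N + 1) * \<rho> j) ^ 2"
          using Fa[OF a] zF[OF a] z1 zd za \<rho>j
          by (intro frac_le mult_mono power_mono mult_nonneg_nonneg) auto
        also have "\<dots> = (1 - norm a) * (1 / (8 * (real N + 1)\<^sup>2 * \<rho> j))"
        proof -
          have "8 * p * u / (8 * M * u) ^ 2 = p * (1 / (8 * M\<^sup>2 * u))" if "u > 0" for p M u :: real
            using that by (cases "M = 0") (auto simp: field_simps power2_eq_square)
          then show ?thesis using \<rho>j .
        qed
        finally show "ln (norm (of_real (r\<^sup>2) - cnj a * z) / (r * norm (z - a))) \<le> \<dots>" .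
      qed auto
      also have "\<dots> = T * (1 / (8 * (real N + 1)\<^sup>2 * \<rho> j))"
        unfolding T_def sum_distrib_right by (simp add: mult_ac)
      also have "\<dots> = c * (1 / (2 * \<rho> j))" by (simp add: c_def)
      also have "\<dots> \<le> c * Re (?P j z)"
        using w1[OF j(1) z1] j \<rho>j by (intro mult_left_mono Re_poisson_ge c) auto
      also have "\<dots> \<le> c * (\<Sum>j=1..N. Re (?P j z))"
        using j(1) by (intro mult_left_mono c member_le_sum Pnn) (auto simp: z1)
      finally show ?thesis .
    qed
    moreover have "ln (norm (h z)) \<le> K * A * (1 + (\<Sum>j=1..N. Re ((1 - ?w j z) powr of_real (- (1 - \<tau>)))))"
    proof -
      let ?x = "\<lambda>j. norm (z - \<xi> j) powr (- (1 - \<tau>))"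
      let ?y = "\<lambda>j. Re ((1 - ?w j z) powr of_real (- (1 - \<tau>)))"
      have "\<kappa> * ?x j \<le> ?y j" if "j \<in> {1..N}" for j
        using Re_powr_minus_ge[OF Rew[OF that z1], of "1 - \<tau>"] \<tau> w1(2)[OF that z1]
        by (simp add: \<kappa>_def)
      then have "\<kappa> * (\<Sum>j=1..N. ?x j) \<le> (\<Sum>j=1..N. ?y j)"
        unfolding sum_distrib_left by (intro sum_mono) auto
      \<comment> \<open>The constant term 1 survives the factor \<kappa> because \<kappa> <=
        1.\<close>
      then have xy: "\<kappa> * (1 + (\<Sum>j=1..N. ?x j)) \<le> 1 + (\<Sum>j=1..N. ?y j)"
        using \<kappa> by (simp add: algebra_simps)
      have "growth \<alpha> \<beta> \<gamma> \<xi> N z \<le> D * \<delta> powr (- \<alpha>)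
          * (\<Prod>j=1..N. \<rho> j powr (- max (\<beta> j - 1 + \<tau>) 0)) * (1 + (\<Sum>j=1..N. ?x j))"
        unfolding D_def using z\<rho> \<rho>(1) zr
        by (intro growth_le \<alpha> \<beta> \<xi> \<tau> d \<delta>) (auto simp: r_def)
      also have "\<dots> = A * (\<kappa> * (1 + (\<Sum>j=1..N. ?x j)))"
        using \<kappa> by (simp add: A_def)
      also have "\<dots> \<le> A * (1 + (\<Sum>j=1..N. ?y j))"
        by (intro mult_left_mono xy A)
      finally have "K * growth \<alpha> \<beta> \<gamma> \<xi> N z \<le> K * (A * (1 + (\<Sum>j=1..N. ?y j)))"
        using K by (intro mult_left_mono) auto
      moreover have "ln (norm (h z)) \<le> K * growth \<alpha> \<beta> \<gamma> \<xi> N z"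
        using bd[of z] z1 z(2) by (intro ln_norm_le_of_elog_le) auto
      ultimately show ?thesis by (simp add: mult_ac)
    qed
    ultimately show "ln (norm (h z)) + ?S \<le> Re (g z)"
      unfolding g_def by simp
  qed
  \<comment> \<open>At the origin every power and every Poisson kernel equals 1, and c N <=
    T/4.\<close>
  also have "Re (g 0) \<le> K * A * (1 + real N) + T / 4"
  proof -
    have "?P j 0 = 1" if "j \<in> {1..N}" for j
    proof -
      have "Re (1 + complex_of_real (\<rho> j)) > 0" using \<rho>(1)[OF that] by simp
      then have "1 + complex_of_real (\<rho> j) \<noteq> 0" by force
      then show ?thesis by simp
    qed
    then have "g 0 = of_real (K * A * (1 + real N) + c * real N)"
      by (simp add: g_def)
    then have "Re (g 0) = K * A * (1 + real N) + c * real N"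
      by (metis Re_complex_of_real)
    moreover have "c * real N \<le> T / 4"
    proof -
      have "real N \<le> (real N + 1)\<^sup>2" by (simp add: power2_eq_square algebra_simps)
      then have "T * real N \<le> T * (real N + 1)\<^sup>2" using T by (rule mult_left_mono)
      then show ?thesis by (simp add: c_def field_simps)
    qed
    ultimately show ?thesis by simp
  qed
  finally have "(\<Sum>a\<in>F. ?n a * ln (r / norm a)) \<le> K * A * (1 + real N) + T / 4" .
  moreover have "T / 2 \<le> (\<Sum>a\<in>F. ?n a * ln (r / norm a))"
    unfolding T_def sum_divide_distrib
  proof (rule sum_mono)
    fix a assume a: "a \<in> F"
    have "a \<noteq> 0" using Fa(3)[OF a] h(2) by auto
    \<comment> \<open>Each zero has depth at least 2 \<delta>, so shrinking the disc by \<delta>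
      loses at most half of its depth.\<close>
    have "(1 - norm a) / 2 \<le> r - norm a" using \<delta>(3)[OF a] by (simp add: r_def field_simps)
    also have "\<dots> \<le> ln (r / norm a)"
      using Fa[OF a] r \<open>a \<noteq> 0\<close> by (intro ln_ratio_ge) auto
    finally have "?n a * ((1 - norm a) / 2) \<le> ?n a * ln (r / norm a)"
      by (rule mult_left_mono) simp
    then show "?n a * (1 - norm a) / 2 \<le> ?n a * ln (r / norm a)" by simp
  qed
  ultimately have "T \<le> 4 * (real N + 1) * (K * A)" by (simp add: algebra_simps)
  then show ?thesis by (simp add: T_def A_def D_def \<kappa>_def mult_ac)
qed

section \<open>Zeros close to the origin\<close>

text \<open>Jensen's inequality on the disc of radius 2t with a constant majorant: each zero in |a|
  <= t contributes at least log 2. On |z| = 2t <= 1/2 all of 1 - |z| and |z - \<xi>| are at least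
  1/2, so the growth is of order t^\<gamma>.\<close>

lemma zeros_near_origin_count_le:
  fixes h :: "complex \<Rightarrow> complex" and \<xi> :: "nat \<Rightarrow> complex"
  assumes \<alpha>: "\<alpha> \<ge> 0" and \<beta>: "\<And>j. j \<in> {1..N} \<Longrightarrow> \<beta> j \<ge> 0"
    and \<xi>: "\<And>j. j \<in> {1..N} \<Longrightarrow> norm (\<xi> j) = 1"
    and K: "K \<ge> 0" and h: "h holomorphic_on ball 0 1" "h 0 = 1"
    and bd: "\<And>z. z \<in> ball 0 1 \<Longrightarrow> elog (norm (h z)) \<le> ereal (K * growth \<alpha> \<beta> \<gamma> \<xi> N z)"
    and t: "0 < t" "t \<le> 1 / 4"
    and F: "finite F" "\<And>a. a \<in> F \<Longrightarrow> norm a \<le> t \<and> h a = 0"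
  shows "(\<Sum>a\<in>F. real (nat (zorder h a))) \<le>
    2 powr (\<alpha> + \<gamma>) * (\<Prod>j=1..N. 2 powr \<beta> j) / ln 2 * K * t powr \<gamma>"
proof -
  let ?n = "\<lambda>a. nat (zorder h a)"
  define B where "B = 2 powr (\<alpha> + \<gamma>) * (\<Prod>j=1..N. 2 powr \<beta> j) * t powr \<gamma>"
  have Fb: "F \<subseteq> ball 0 1" using F(2) t by force
  obtain q where q: "q holomorphic_on ball 0 1"
      "\<And>z. z \<in> ball 0 1 \<Longrightarrow> h z = (\<Prod>a\<in>F. (z - a) ^ ?n a) * q z"
    using holomorphic_factor_zeros[OF h(1) open_ball connected_ball _ F(1) Fb] h(2)
    by (metis centre_in_ball zero_less_one zero_neq_one)
  have "(\<Sum>a\<in>F. ?n a * ln (2 * t / norm a)) \<le> Re (of_real (K * B))"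
  proof (rule jensen_inequality_domain[OF q h(2) F(1), where \<Omega> = "ball 0 (2 * t)"])
    show "F \<subseteq> ball 0 (2 * t)" using F(2) t by force
    show "0 \<notin> F" using F(2) h(2) by force
    fix z assume z: "z \<in> frontier (ball 0 (2 * t))" "h z \<noteq> 0"
    then have zt: "norm z = 2 * t" using t by simp
    have "(\<Sum>a\<in>F. ?n a * ln (norm (of_real ((2 * t)\<^sup>2) - cnj a * z) / (2 * t * norm (z - a)))) \<le> 0"
    proof (intro sum_nonpos mult_nonneg_nonpos)
      fix a assume a: "a \<in> F"
      have "norm a < 2 * t" "z \<noteq> a" using F(2)[OF a] t z by auto
      then show "ln (norm (of_real ((2 * t)\<^sup>2) - cnj a * z) / (2 * t * norm (z - a))) \<le> 0"
        using ln_inverse_blaschke_le[of "2 * t" a z] t zt by simp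
    qed auto
    moreover have "ln (norm (h z)) \<le> K * growth \<alpha> \<beta> \<gamma> \<xi> N z"
      using bd[of z] zt t z(2) by (intro ln_norm_le_of_elog_le) auto
    moreover have "growth \<alpha> \<beta> \<gamma> \<xi> N z \<le> B"
    proof -
      have half: "1 / u powr b \<le> 2 powr b" if "1 / 2 \<le> u" "0 \<le> b" for u b :: real
      proof -
        have "u powr (- b) \<le> (1 / 2) powr (- b)" using that by (intro powr_mono2') auto
        then show ?thesis by (simp add: powr_minus_divide powr_divide)
      qed
      have "(\<Prod>j=1..N. 1 / norm (z - \<xi> j) powr \<beta> j) \<le> (\<Prod>j=1..N. 2 powr \<beta> j)"
      proof (intro prod_mono conjI half \<beta>)
        fix j assume j: "j \<in> {1..N}"
        show "1 / 2 \<le> norm (z - \<xi> j)"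
          using norm_triangle_ineq4[of z "z - \<xi> j"] \<xi>[OF j] zt t by simp
      qed auto
      moreover have "norm z powr \<gamma> / (1 - norm z) powr \<alpha> \<le> (2 * t) powr \<gamma> * 2 powr \<alpha>"
        using mult_left_mono[OF half[of "1 - norm z" \<alpha>], of "norm z powr \<gamma>"] zt t \<alpha> by simp
      ultimately have "growth \<alpha> \<beta> \<gamma> \<xi> N z \<le> ((2 * t) powr \<gamma> * 2 powr \<alpha>) * (\<Prod>j=1..N. 2 powr \<beta> j)"
        unfolding growth_def by (intro mult_mono) (auto intro!: prod_nonneg)
      also have "\<dots> = B" using t by (simp add: B_def powr_mult powr_add mult_ac)
      finally show ?thesis .
    qed
    then have "K * growth \<alpha> \<beta> \<gamma> \<xi> N z \<le> K * B" using K by (rule mult_left_mono)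
    ultimately show "ln (norm (h z)) + (\<Sum>a\<in>F. ?n a * ln (norm (of_real ((2 * t)\<^sup>2) - cnj a * z) / (2 * t * norm (z - a))))
        \<le> Re (of_real (K * B))" by simp
  qed (use t in auto)
  moreover have "(\<Sum>a\<in>F. ?n a * ln 2) \<le> (\<Sum>a\<in>F. ?n a * ln (2 * t / norm a))"
  proof (intro sum_mono mult_left_mono)
    fix a assume a: "a \<in> F"
    have "a \<noteq> 0" using F(2)[OF a] h(2) by auto
    then show "ln 2 \<le> ln (2 * t / norm a)"
      using F(2)[OF a] t by (subst ln_le_cancel_iff) (auto simp: field_simps)
  qed auto
  ultimately have "(\<Sum>a\<in>F. real (?n a)) * ln 2 \<le> K * B"
    by (simp add: sum_distrib_right)
  then show ?thesis by (simp add: B_def field_simps)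
qed

text \<open>For an empty set of zeros Jensen's inequality says that log|h 0| = 0 is at most any
  constant bounding log|h| on |z| = 1/2. If K were negative, K times a positive lower bound c of the
  growth there would be such a constant.\<close>

lemma growth_bound_nonneg:
  fixes h :: "complex \<Rightarrow> complex" and \<xi> :: "nat \<Rightarrow> complex"
  assumes \<beta>: "\<And>j. j \<in> {1..N} \<Longrightarrow> \<beta> j \<ge> 0"
    and \<xi>: "\<And>j. j \<in> {1..N} \<Longrightarrow> norm (\<xi> j) = 1"
    and h: "h holomorphic_on ball 0 1" "h 0 = 1"
    and bd: "\<And>z. z \<in> ball 0 1 \<Longrightarrow> elog (norm (h z)) \<le> ereal (K * growth \<alpha> \<beta> \<gamma> \<xi> N z)"
  shows "K \<ge> 0"
proof (rule ccontr)
  assume "\<not> K \<ge> 0"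
  then have K: "K \<le> 0" "K < 0" by auto
  define c where "c = (1 / 2) powr \<gamma> / (1 - 1 / 2) powr \<alpha> * (\<Prod>j=1..N. 1 / 2 powr \<beta> j)"
  have c: "c > 0" unfolding c_def by (intro mult_pos_pos prod_pos) auto
  have "(\<Sum>a\<in>{}. real (0::nat) * ln (1 / 2 / norm (a::complex))) \<le> Re (of_real (K * c))"
  proof (rule jensen_inequality_domain[where q = h and h = h and n = "\<lambda>_. 0" and \<Omega> = "ball 0 (1 / 2)"])
    fix z assume z: "z \<in> frontier (ball (0::complex) (1 / 2))" "h z \<noteq> 0"
    then have zt: "norm z = 1 / 2" by simp
    have "(\<Prod>j=1..N. 1 / 2 powr \<beta> j) \<le> (\<Prod>j=1..N. 1 / norm (z - \<xi> j) powr \<beta> j)"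
    proof (intro prod_mono conjI divide_left_mono powr_mono2 mult_pos_pos)
      fix j assume j: "j \<in> {1..N}"
      show "norm (z - \<xi> j) \<le> 2"
        using norm_triangle_ineq4[of z "\<xi> j"] zt \<xi>[OF j] by simp
      show "0 < norm (z - \<xi> j) powr \<beta> j"
        using zt \<xi>[OF j] by auto
    qed (use \<beta> in auto)
    then have "c \<le> growth \<alpha> \<beta> \<gamma> \<xi> N z"
      unfolding c_def growth_def zt by (intro mult_left_mono) auto
    then have "K * growth \<alpha> \<beta> \<gamma> \<xi> N z \<le> K * c" using K(1) by (rule mult_left_mono_neg)
    moreover have "ln (norm (h z)) \<le> K * growth \<alpha> \<beta> \<gamma> \<xi> N z"
      using bd[of z] zt z(2) by (intro ln_norm_le_of_elog_le) auto
    ultimately show "ln (norm (h z)) + (\<Sum>a\<in>{}. real (0::nat) * ln (norm (of_real ((1 / 2)\<^sup>2) - cnj a * z) / (1 / 2 * norm (z - a))))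
        \<le> Re (of_real (K * c))" by simp
  qed (use h in auto)
  then have "0 \<le> K * c" by simp
  then show False using K(2) c by (simp add: zero_le_mult_iff)
qed

section \<open>Summation over dyadic ranges\<close>

lemma dyadic_bracket:
  fixes x :: real
  assumes "0 < x" "x \<le> 1"
  shows "\<exists>m::nat. (1 / 2) ^ Suc m < x \<and> x \<le> (1 / 2) ^ m"
proof -
  define m where "m = (LEAST m. (1 / 2) ^ Suc m < x)"
  obtain k where "(1 / 2) ^ k < x" using real_arch_pow_inv[of x "1 / 2"] assms by auto
  moreover have "(1 / 2 :: real) ^ Suc k \<le> (1 / 2) ^ k" by simp
  ultimately have "(1 / 2) ^ Suc k < x" by linarith
  then have m: "(1 / 2) ^ Suc m < x" unfolding m_def by (rule LeastI)
  have "x \<le> (1 / 2) ^ m"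
  proof (cases m)
    case (Suc l)
    then have "\<not> (1 / 2) ^ Suc l < x"
      using not_less_Least[of l "\<lambda>m. (1 / 2) ^ Suc m < x"] by (simp add: m_def)
    then show ?thesis using Suc by simp
  qed (use assms in simp)
  with m show ?thesis by blast
qed

lemma power_powr_commute:
  fixes y :: real
  assumes "y \<ge> 0"
  shows "(y ^ k) powr s = (y powr s) ^ k"
  using assms by (induction k) (auto simp: powr_mult)

lemma sum_le_sum_classes:
  fixes f :: "'a \<Rightarrow> real"
  assumes "finite F" "\<And>y. y \<in> key ` F \<Longrightarrow> sum f {a \<in> F. key a = y} \<le> u y"
  shows "sum f F \<le> sum u (key ` F)"
  unfolding sum.image_gen[OF assms(1), of f key] by (intro sum_mono assms(2))

text \<open>Ratio test: the quotients tend to x and are eventually below (1 + x) / 2. The polynomial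
  will count the classes of zeros at depth m, with m + 2 dyadic distances for each of N
  points.\<close>

lemma summable_poly_mult_power:
  fixes x :: real
  assumes "0 < x" "x < 1"
  shows "summable (\<lambda>m. (real m + 2) ^ N * x ^ m)"
proof -
  have "(\<lambda>m. inverse (real (Suc (Suc m)))) \<longlonglongrightarrow> 0"
    using LIMSEQ_inverse_real_of_nat LIMSEQ_Suc by blast
  then have "(\<lambda>m. (1 + inverse (real (Suc (Suc m)))) ^ N * x) \<longlonglongrightarrow> (1 + 0) ^ N * x"
    by (intro tendsto_intros)
  then have "eventually (\<lambda>m. (1 + inverse (real (Suc (Suc m)))) ^ N * x < (1 + x) / 2) sequentially"
    using assms by (intro order_tendstoD) auto
  then obtain M where M: "\<And>m. m \<ge> M \<Longrightarrow> (1 + inverse (real (Suc (Suc m)))) ^ N * x < (1 + x) / 2"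
    by (auto simp: eventually_sequentially)
  show ?thesis
  proof (rule summable_ratio_test)
    show "(1 + x) / 2 < 1" using assms by simp
    fix m assume "M \<le> m"
    have "real (Suc m) + 2 = (1 + inverse (real (Suc (Suc m)))) * (real m + 2)"
      by (simp add: field_simps)
    then have "(real (Suc m) + 2) ^ N * x ^ Suc m
        = ((1 + inverse (real (Suc (Suc m)))) ^ N * x) * ((real m + 2) ^ N * x ^ m)"
      by (simp add: power_mult_distrib mult_ac)
    also have "\<dots> \<le> (1 + x) / 2 * ((real m + 2) ^ N * x ^ m)"
      using M[OF \<open>M \<le> m\<close>] assms by (intro mult_right_mono) auto
    finally show "norm ((real (Suc m) + 2) ^ N * x ^ Suc m) \<le> (1 + x) / 2 * norm ((real m + 2) ^ N * x ^ m)"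
      using assms by simp
  qed
qed

text \<open>A shell |a| ~ 2^(-k) has O(K 2^(-k \<gamma>)) zeros of weight O(2^(k c)). For c =
  \<gamma> - 1 + \<tau> > 0 the product decays like 2^(-k (1 - \<tau>)), which is where \<tau> < 1
  enters; for c = 0 a single count suffices.\<close>

lemma sum_near_origin_le:
  fixes \<xi> :: "nat \<Rightarrow> complex" and \<tau> :: real
  assumes \<alpha>: "\<alpha> \<ge> 0" "\<gamma> \<ge> 0" and \<beta>: "\<And>j. j \<in> {1..N} \<Longrightarrow> \<beta> j \<ge> 0"
    and \<xi>: "\<And>j. j \<in> {1..N} \<Longrightarrow> norm (\<xi> j) = 1"
    and \<tau>: "0 < \<tau>" "\<tau> < 1"
  shows "\<exists>C. \<forall>K h F. K \<ge> 0 \<longrightarrow> h holomorphic_on ball 0 1 \<longrightarrow> h 0 = 1 \<longrightarrow>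
    (\<forall>z\<in>ball 0 1. elog (norm (h z)) \<le> ereal (K * growth \<alpha> \<beta> \<gamma> \<xi> N z)) \<longrightarrow>
    finite F \<longrightarrow> (\<forall>a\<in>F. norm a \<le> 1 / 4 \<and> h a = 0) \<longrightarrow>
    (\<Sum>a\<in>F. nat (zorder h a) * zero_weight \<alpha> \<beta> \<gamma> \<xi> N \<tau> a) \<le> C * K"
proof -
  define c where "c = max (\<gamma> - 1 + \<tau>) 0"
  define W where "W = (\<Prod>j=1..N. 2 powr max (\<beta> j - 1 + \<tau>) 0)"
  define B where "B = 2 powr (\<alpha> + \<gamma>) * (\<Prod>j=1..N. 2 powr \<beta> j) / ln 2"
  define x where "x = (1 / 2) powr (1 - \<tau>)"
  have W: "W \<ge> 0" unfolding W_def by (intro prod_nonneg) auto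
  have B: "B \<ge> 0" unfolding B_def by (intro divide_nonneg_nonneg mult_nonneg_nonneg prod_nonneg) auto
  have x: "0 < x" "x < 1" using \<tau> powr_less_mono2_neg[of "- (1 - \<tau>)" 1 2]
    by (auto simp: x_def powr_divide powr_minus_divide)
  have weight: "zero_weight \<alpha> \<beta> \<gamma> \<xi> N \<tau> a \<le> W * norm a powr (- c)" if "norm a \<le> 1 / 4" for a
  proof -
    have "(\<Prod>j=1..N. norm (a - \<xi> j) powr max (\<beta> j - 1 + \<tau>) 0) \<le> W"
      unfolding W_def
    proof (intro prod_mono conjI powr_mono2)
      fix j assume j: "j \<in> {1..N}"
      show "norm (a - \<xi> j) \<le> 2"
        using norm_triangle_ineq4[of a "\<xi> j"] that \<xi>[OF j] by simp
    qed auto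
    moreover have "(1 - norm a) powr (\<alpha> + 1 + \<tau>) \<le> 1"
      using that \<alpha> \<tau> by (intro powr_le1) auto
    then have "(1 - norm a) powr (\<alpha> + 1 + \<tau>) / norm a powr c \<le> 1 / norm a powr c"
      by (rule divide_right_mono) simp
    ultimately have "zero_weight \<alpha> \<beta> \<gamma> \<xi> N \<tau> a \<le> 1 / norm a powr c * W"
      unfolding zero_weight_def c_def[symmetric] by (intro mult_mono) (auto intro!: prod_nonneg)
    then show ?thesis by (simp add: powr_minus_divide)
  qed
  show ?thesis
  proof (intro exI[of _ "W * B * (1 + 2 powr c * (\<Sum>m. x ^ m))"] allI impI)
    fix K :: real and h F
    assume K: "K \<ge> 0" and h: "h holomorphic_on ball 0 1" "h 0 = 1"
      and bd: "\<forall>z\<in>ball 0 1. elog (norm (h z)) \<le> ereal (K * growth \<alpha> \<beta> \<gamma> \<xi> N z)"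
      and F: "finite F" "\<forall>a\<in>F. norm a \<le> 1 / 4 \<and> h a = 0"
    let ?n = "\<lambda>a. nat (zorder h a)"
    have count: "(\<Sum>a\<in>G. real (?n a)) \<le> B * K * t powr \<gamma>"
      if "G \<subseteq> F" "0 < t" "t \<le> 1 / 4" "\<And>a. a \<in> G \<Longrightarrow> norm a \<le> t" for G t
      unfolding B_def using that F bd finite_subset[OF that(1)]
      by (intro zeros_near_origin_count_le[where h = h and \<xi> = \<xi>] \<alpha> \<beta> \<xi> K h) auto
    have F0: "norm a > 0" if "a \<in> F" for a using F(2) that h(2) by force
    have S: "0 \<le> (\<Sum>m. x ^ m)" using x by (intro suminf_nonneg summable_geometric) auto
    have "(\<Sum>a\<in>F. ?n a * zero_weight \<alpha> \<beta> \<gamma> \<xi> N \<tau> a) \<le> (\<Sum>a\<in>F. ?n a * (W * norm a powr (- c)))"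
      using F by (intro sum_mono mult_left_mono weight) auto
    also have "\<dots> = W * (\<Sum>a\<in>F. ?n a * norm a powr (- c))"
      by (simp add: sum_distrib_left mult_ac)
    also have "\<dots> \<le> W * (B * K * (1 + 2 powr c * (\<Sum>m. x ^ m)))"
    proof (rule mult_left_mono[OF _ W])
      show "(\<Sum>a\<in>F. ?n a * norm a powr (- c)) \<le> B * K * (1 + 2 powr c * (\<Sum>m. x ^ m))"
      proof (cases "c = 0")
        case True
        have "(\<Sum>a\<in>F. ?n a * norm a powr (- c)) = (\<Sum>a\<in>F. real (?n a))"
          using True F0 by (intro sum.cong) force+
        also have "\<dots> \<le> B * K * (1 / 4) powr \<gamma>" using F by (intro count) auto
        also have "\<dots> \<le> B * K * (1 + 2 powr c * (\<Sum>m. x ^ m))"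
        proof (intro mult_left_mono)
          have "(1 / 4) powr \<gamma> \<le> 1" using \<alpha> by (intro powr_le1) auto
          moreover have "0 \<le> 2 powr c * (\<Sum>m. x ^ m)" using S by simp
          ultimately show "(1 / 4) powr \<gamma> \<le> 1 + 2 powr c * (\<Sum>m. x ^ m)" by linarith
        qed (use B K in simp)
        finally show ?thesis .
      next
        case False
        then have c: "c = \<gamma> - 1 + \<tau>" "c > 0" by (auto simp: c_def)
        have "\<forall>a\<in>F. \<exists>m. (1 / 2) ^ Suc m < norm a \<and> norm a \<le> (1 / 2) ^ m"
        proof
          fix a assume "a \<in> F"
          then show "\<exists>m. (1 / 2) ^ Suc m < norm a \<and> norm a \<le> (1 / 2) ^ m"
            using F0[of a] F(2) by (intro dyadic_bracket) force+
        qed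
        then obtain m where m: "\<And>a. a \<in> F \<Longrightarrow> (1 / 2) ^ Suc (m a) < norm a \<and> norm a \<le> (1 / 2) ^ m a"
          by metis
        have "(\<Sum>a\<in>F. ?n a * norm a powr (- c)) \<le> (\<Sum>k\<in>m ` F. B * K * 2 powr c * x ^ k)"
        proof (rule sum_le_sum_classes[OF F(1)])
          fix k assume "k \<in> m ` F"
          then obtain a0 where a0: "a0 \<in> F" "m a0 = k" by auto
          let ?G = "{a \<in> F. m a = k}"
          \<comment> \<open>A nonempty shell has k >= 2, so its outer radius respects the limit 1/4
            in \<open>count\<close>.\<close>
          have "(1 / 2 :: real) ^ Suc k < (1 / 2) ^ 2"
            using m[OF a0(1)] a0 F(2) by (auto simp: power2_eq_square)
          then have "k \<ge> 2" by (subst (asm) power_strict_decreasing_iff) auto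
          then have k: "(1 / 2 :: real) ^ k \<le> (1 / 2) ^ 2" by (intro power_decreasing) auto
          have "(\<Sum>a\<in>?G. ?n a * norm a powr (- c)) \<le> (\<Sum>a\<in>?G. ?n a * ((1 / 2) ^ Suc k) powr (- c))"
            using m c by (intro sum_mono mult_left_mono powr_mono2') (auto simp: less_imp_le)
          also have "\<dots> = (\<Sum>a\<in>?G. real (?n a)) * ((1 / 2) ^ Suc k) powr (- c)"
            by (simp add: sum_distrib_right)
          also have "\<dots> \<le> B * K * ((1 / 2) ^ k) powr \<gamma> * ((1 / 2) ^ Suc k) powr (- c)"
            using m k by (intro mult_right_mono count) (auto simp: power2_eq_square)
          also have "\<dots> = B * K * 2 powr c * x ^ k"
          proof -
            \<comment> \<open>The factor \<open>2 powr c\<close> comes from the inner radius of the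
              shell, half of the outer one.\<close>
            have "((1 / 2) ^ k) powr \<gamma> * ((1 / 2) ^ Suc k) powr (- c)
                = 2 powr c * (((1 / 2) ^ k) powr \<gamma> * ((1 / 2) ^ k) powr (- c))"
              by (simp add: powr_mult powr_divide powr_minus_divide)
            also have "((1 / 2) ^ k) powr \<gamma> * ((1 / 2) ^ k) powr (- c) = ((1 / 2) ^ k) powr (1 - \<tau>)"
              unfolding powr_add[symmetric] c(1) by simp
            also have "\<dots> = x ^ k"
              unfolding x_def by (rule power_powr_commute) simp
            finally show ?thesis by (simp add: mult_ac)
          qed
          finally show "(\<Sum>a\<in>?G. ?n a * norm a powr (- c)) \<le> \<dots>" .
        qed
        also have "\<dots> = B * K * 2 powr c * (\<Sum>k\<in>m ` F. x ^ k)" by (simp add: sum_distrib_left)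
        also have "\<dots> \<le> B * K * 2 powr c * (\<Sum>m. x ^ m)"
          using x B K F by (intro mult_left_mono sum_le_suminf summable_geometric) auto
        also have "\<dots> \<le> B * K * (1 + 2 powr c * (\<Sum>m. x ^ m))"
          using B K by (simp add: algebra_simps)
        finally show ?thesis .
      qed
    qed
    finally show "(\<Sum>a\<in>F. ?n a * zero_weight \<alpha> \<beta> \<gamma> \<xi> N \<tau> a) \<le> W * B * (1 + 2 powr c * (\<Sum>m. x ^ m)) * K"
      using W by (simp add: mult_ac)
  qed
qed

lemma separation_constant:
  fixes \<xi> :: "nat \<Rightarrow> complex"
  assumes "inj_on \<xi> J" "finite J"
  obtains d where "0 < d" "d \<le> 1"
    "\<And>i j. i \<in> J \<Longrightarrow> j \<in> J \<Longrightarrow> i \<noteq> j \<Longrightarrow> 2 * d \<le> norm (\<xi> i - \<xi> j)"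
proof -
  \<comment> \<open>The extra element 2 makes the minimum exist when there are no pairs, and forces
    d <= 1.\<close>
  define E where "E = insert 2 ((\<lambda>(i, j). norm (\<xi> i - \<xi> j)) ` ((J \<times> J) \<inter> {(i, j). i \<noteq> j}))"
  have fin: "finite E" unfolding E_def using assms(2) by auto
  have "Min E > 0"
    using fin assms(1) by (subst Min_gr_iff) (auto simp: E_def inj_on_def)
  moreover have "Min E \<le> 2" using fin by (intro Min_le) (auto simp: E_def)
  moreover have "Min E \<le> norm (\<xi> i - \<xi> j)" if "i \<in> J" "j \<in> J" "i \<noteq> j" for i j
    using fin that by (intro Min_le) (auto simp: E_def)
  ultimately show ?thesis by (intro that[of "Min E / 2"]) auto
qed

text \<open>Zeros are classed by the dyadic sizes of 1 - |a| and of all |a - \<xi>|. In a class the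
  powers of the distances cancel against those in \<open>zeros_depth_sum_le\<close>, and the depth
  keeps only the power \<tau>; this beats the polynomial number of classes at each depth.\<close>

lemma sum_away_from_origin_le:
  fixes \<xi> :: "nat \<Rightarrow> complex" and \<tau> :: real
  assumes \<alpha>: "\<alpha> \<ge> 0" "\<gamma> \<ge> 0" and \<beta>: "\<And>j. j \<in> {1..N} \<Longrightarrow> \<beta> j \<ge> 0"
    and \<xi>: "\<And>j. j \<in> {1..N} \<Longrightarrow> norm (\<xi> j) = 1" "inj_on \<xi> {1..N}"
    and \<tau>: "0 < \<tau>" "\<tau> < 1"
  shows "\<exists>C. \<forall>K h F. K \<ge> 0 \<longrightarrow> h holomorphic_on ball 0 1 \<longrightarrow> h 0 = 1 \<longrightarrow>
    (\<forall>z\<in>ball 0 1. elog (norm (h z)) \<le> ereal (K * growth \<alpha> \<beta> \<gamma> \<xi> N z)) \<longrightarrow>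
    finite F \<longrightarrow> (\<forall>a\<in>F. 1 / 4 \<le> norm a \<and> norm a < 1 \<and> h a = 0) \<longrightarrow>
    (\<Sum>a\<in>F. nat (zorder h a) * zero_weight \<alpha> \<beta> \<gamma> \<xi> N \<tau> a) \<le> C * K"
proof -
  obtain d where d: "0 < d" "d \<le> 1"
    "\<And>i j. i \<in> {1..N} \<Longrightarrow> j \<in> {1..N} \<Longrightarrow> i \<noteq> j \<Longrightarrow> 2 * d \<le> norm (\<xi> i - \<xi> j)"
    using separation_constant[OF \<xi>(2)] by auto
  let ?b = "\<lambda>j. max (\<beta> j - 1 + \<tau>) 0"
  define c where "c = max (\<gamma> - 1 + \<tau>) 0"
  define C0 where "C0 = 4 * (real N + 1) * ((2 * d powr (- (1 - \<tau>))) ^ N / cos ((1 - \<tau>) * pi / 2))"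
  define M where "M = 1 + 8 * (real N + 1)"
  define C1 where "C1 = C0 * 4 powr \<alpha> * 4 powr c * (\<Prod>j=1..N. (2 * M) powr ?b j)"
  define x where "x = (1 / 2) powr \<tau>"
  have M: "M > 1" by (simp add: M_def)
  have x: "0 < x" "x < 1" using \<tau> powr_less_mono2_neg[of "- \<tau>" 1 2]
    by (auto simp: x_def powr_divide powr_minus_divide)
  have "0 < cos ((1 - \<tau>) * pi / 2)"
    using \<tau> by (intro cos_fraction_half_pi_pos) auto
  then have C0: "C0 \<ge> 0"
    unfolding C0_def by (intro mult_nonneg_nonneg divide_nonneg_nonneg) auto
  then have C1: "C1 \<ge> 0"
    unfolding C1_def by (intro mult_nonneg_nonneg prod_nonneg) auto
  show ?thesis
  proof (intro exI[of _ "C1 * (\<Sum>m. (real m + 2) ^ N * x ^ m)"] allI impI)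
    fix K :: real and h F
    assume K: "K \<ge> 0" and h: "h holomorphic_on ball 0 1" "h 0 = 1"
      and bd: "\<forall>z\<in>ball 0 1. elog (norm (h z)) \<le> ereal (K * growth \<alpha> \<beta> \<gamma> \<xi> N z)"
      and F: "finite F" "\<forall>a\<in>F. 1 / 4 \<le> norm a \<and> norm a < 1 \<and> h a = 0"
    let ?n = "\<lambda>a. nat (zorder h a)"
    let ?f = "\<lambda>a. ?n a * zero_weight \<alpha> \<beta> \<gamma> \<xi> N \<tau> a"
    have F1: "norm a < 1" "1 / 4 \<le> norm a" "h a = 0" if "a \<in> F" for a using F(2) that by auto
    have "\<forall>a\<in>F. \<exists>m. (1 / 2) ^ Suc m < 1 - norm a \<and> 1 - norm a \<le> (1 / 2) ^ m"
      using F1 by (intro ballI dyadic_bracket) auto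
    then obtain m where m: "\<And>a. a \<in> F \<Longrightarrow> (1 / 2) ^ Suc (m a) < 1 - norm a"
        "\<And>a. a \<in> F \<Longrightarrow> 1 - norm a \<le> (1 / 2) ^ m a"
      by metis
    have dist_ge: "1 - norm a \<le> norm (a - \<xi> j)" if "j \<in> {1..N}" for a j
      using norm_triangle_ineq2[of "\<xi> j" a] \<xi>(1)[OF that] by (simp add: norm_minus_commute)
    \<comment> \<open>Distances to points of the unit circle can approach 2, hence the halving
      before bracketing.\<close>
    have "\<exists>k. (1 / 2) ^ Suc k < norm (a - \<xi> j) / 2 \<and> norm (a - \<xi> j) / 2 \<le> (1 / 2) ^ k"
      if "a \<in> F" "j \<in> {1..N}" for a j
    proof (rule dyadic_bracket)
      show "norm (a - \<xi> j) / 2 \<le> 1"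
        using norm_triangle_ineq4[of a "\<xi> j"] F1[OF that(1)] \<xi>(1)[OF that(2)] by simp
      show "0 < norm (a - \<xi> j) / 2"
        using dist_ge[OF that(2), of a] F1[OF that(1)] \<xi>(1)[OF that(2)] by auto
    qed
    then obtain k where k': "\<And>a j. a \<in> F \<Longrightarrow> j \<in> {1..N} \<Longrightarrow>
        (1 / 2) ^ Suc (k a j) < norm (a - \<xi> j) / 2 \<and> norm (a - \<xi> j) / 2 \<le> (1 / 2) ^ k a j"
      by metis
    have k: "(1 / 2) ^ k a j \<le> norm (a - \<xi> j)" "norm (a - \<xi> j) \<le> 2 * (1 / 2) ^ k a j"
      if "a \<in> F" "j \<in> {1..N}" for a j
      using k'[OF that] by auto
    \<comment> \<open>A zero is no closer to \<open>\<xi> j\<close> than to the unit circle, so its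
      depth limits k to m + 2 values.\<close>
    have km: "k a j \<le> m a + 1" if "a \<in> F" "j \<in> {1..N}" for a j
    proof (rule ccontr)
      assume "\<not> k a j \<le> m a + 1"
      then have "Suc (Suc (m a)) \<le> k a j" by simp
      then have "(1 / 2 :: real) ^ k a j \<le> (1 / 2) ^ Suc (Suc (m a))" by (intro power_decreasing) auto
      then show False using k(2)[OF that] dist_ge[OF that(2), of a] m(1)[OF that(1)] by simp
    qed
    \<comment> \<open>Restricting makes keys extensional, so that they can be counted in a finite
      \<open>PiE\<close>.\<close>
    define key where "key a = (m a, restrict (k a) {1..N})" for a
    have cls: "sum ?f {a \<in> F. key a = y} \<le> C1 * K * x ^ fst y" if "y \<in> key ` F" for y
    proof -
      obtain l \<kappa> where y: "y = (l, \<kappa>)" by (cases y)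
      let ?G = "{a \<in> F. key a = y}"
      have G: "m a = l" "\<And>j. j \<in> {1..N} \<Longrightarrow> k a j = \<kappa> j" "a \<in> F" if "a \<in> ?G" for a
      proof -
        have "key a = (l, \<kappa>)" "a \<in> F" using that y by auto
        then show "m a = l" "a \<in> F" by (auto simp: key_def)
        have "\<kappa> = restrict (k a) {1..N}" using \<open>key a = (l, \<kappa>)\<close> by (simp add: key_def)
        then show "k a j = \<kappa> j" if "j \<in> {1..N}" for j using that by simp
      qed
      define X where "X = (1 / 2 :: real) ^ l"
      define Y where "Y j = (1 / 2 :: real) ^ \<kappa> j" for j
      have X: "0 < X" "X \<le> 1" by (auto simp: X_def power_le_one)
      have Y: "0 < Y j" "Y j \<le> 1" for j by (auto simp: Y_def power_le_one)
      \<comment> \<open>A bound on the class for the weight after removal of one factor 1 - |a|,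
        which stays for \<open>zeros_depth_sum_le\<close>; \<open>4 powr c\<close> uses |a| >=
        1/4.\<close>
      define Q where "Q = X powr (\<alpha> + \<tau>) * 4 powr c * (\<Prod>j=1..N. (2 * Y j) powr ?b j)"
      have Q: "Q \<ge> 0" unfolding Q_def by (intro mult_nonneg_nonneg prod_nonneg) auto
      have "sum ?f ?G \<le> (\<Sum>a\<in>?G. ?n a * (1 - norm a) * Q)"
      proof (rule sum_mono)
        fix a assume a: "a \<in> ?G"
        note a1 = F1[OF G(3)[OF a]]
        have "zero_weight \<alpha> \<beta> \<gamma> \<xi> N \<tau> a
            = (1 - norm a) * ((1 - norm a) powr (\<alpha> + \<tau>) * (1 / norm a powr c)
              * (\<Prod>j=1..N. norm (a - \<xi> j) powr ?b j))"
        proof -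
          have "(1 - norm a) powr (\<alpha> + 1 + \<tau>) = (1 - norm a) powr 1 * (1 - norm a) powr (\<alpha> + \<tau>)"
            unfolding powr_add[symmetric] by (simp add: add_ac)
          then show ?thesis using a1 by (simp add: zero_weight_def c_def)
        qed
        also have "\<dots> \<le> (1 - norm a) * Q"
          unfolding Q_def
        proof (intro mult_left_mono mult_mono prod_mono conjI powr_mono2)
          show "1 - norm a \<le> X" using m(2)[OF G(3)[OF a]] G(1)[OF a] by (simp add: X_def)
          have "norm a powr (- c) \<le> (1 / 4) powr (- c)"
            using a1 by (intro powr_mono2') (auto simp: c_def)
          then show "1 / norm a powr c \<le> 4 powr c" by (simp add: powr_minus_divide powr_divide)
          fix j assume j: "j \<in> {1..N}"
          show "norm (a - \<xi> j) \<le> 2 * Y j"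
            using k(2)[OF G(3)[OF a] j] G(2)[OF a j] by (simp add: Y_def)
        qed (use a1 \<alpha> \<tau> in \<open>auto intro!: prod_nonneg\<close>)
        finally have "?n a * zero_weight \<alpha> \<beta> \<gamma> \<xi> N \<tau> a \<le> ?n a * ((1 - norm a) * Q)"
          by (rule mult_left_mono) simp
        then show "?f a \<le> ?n a * (1 - norm a) * Q" by (simp add: mult_ac)
      qed
      also have "\<dots> = (\<Sum>a\<in>?G. ?n a * (1 - norm a)) * Q" by (simp add: sum_distrib_right)
      also have "\<dots> \<le> C0 * K * (X / 4) powr (- \<alpha>) * (\<Prod>j=1..N. (Y j / M) powr (- ?b j)) * Q"
        unfolding C0_def
      \<comment> \<open>The choices \<delta> = X/4 and \<rho> = Y/M turn its separation conditions
        into the lower ends of the dyadic brackets.\<close>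
      proof (intro mult_right_mono[OF _ Q] zeros_depth_sum_le[where h = h and \<xi> = \<xi> and \<gamma> = \<gamma>])
        show "0 < X / 4" "X / 4 \<le> 1 / 4" using X by auto
        show "2 * (X / 4) \<le> 1 - norm a" if "a \<in> ?G" for a
          using m(1)[OF G(3)[OF that]] G(1)[OF that] by (simp add: X_def)
        show "0 < Y j / M" for j using M Y by simp
        show "Y j / M < 1" for j using M Y(2)[of j] by simp
        show "(1 + 8 * (real N + 1)) * (Y j / M) \<le> norm (a - \<xi> j)"
          if "a \<in> ?G" "j \<in> {1..N}" for a j
          unfolding M_def[symmetric]
          using k(1)[OF G(3)[OF that(1)] that(2)] G(2)[OF that] M by (simp add: Y_def)
      qed (use \<alpha> \<beta> \<xi> \<tau> d K h bd F in auto)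
      also have "\<dots> = C1 * K * x ^ l"
      proof -
        have "(X / 4) powr (- \<alpha>) * X powr (\<alpha> + \<tau>) = 4 powr \<alpha> * (X powr (- \<alpha>) * X powr (\<alpha> + \<tau>))"
          using X by (simp add: powr_divide powr_minus_divide)
        also have "X powr (- \<alpha>) * X powr (\<alpha> + \<tau>) = X powr \<tau>"
          unfolding powr_add[symmetric] by simp
        also have "\<dots> = x ^ l" unfolding X_def x_def by (rule power_powr_commute) simp
        finally have 1: "(X / 4) powr (- \<alpha>) * X powr (\<alpha> + \<tau>) = 4 powr \<alpha> * x ^ l" .
        have "(Y j / M) powr (- ?b j) * (2 * Y j) powr ?b j = (2 * M) powr ?b j" for j
        proof -
          have "Y j powr ?b j > 0" "M powr ?b j > 0" using Y[of j] M by auto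
          then show ?thesis
            using Y[of j] M by (simp add: powr_divide powr_mult powr_minus_divide)
        qed
        then have 2: "(\<Prod>j=1..N. (Y j / M) powr (- ?b j)) * (\<Prod>j=1..N. (2 * Y j) powr ?b j)
            = (\<Prod>j=1..N. (2 * M) powr ?b j)"
          by (simp flip: prod.distrib)
        have 3: "C0 * K * u * v * (p * q * w) = C0 * K * q * (u * p) * (v * w)" for u v p q w
          by (simp only: mult_ac)
        show ?thesis unfolding Q_def C1_def 3 1 2 by (simp only: mult_ac)
      qed
      finally show ?thesis by (simp add: y)
    qed
    define L where "L = Max (insert 0 (m ` F))"
    have "sum ?f F \<le> (\<Sum>y\<in>key ` F. C1 * K * x ^ fst y)"
      by (rule sum_le_sum_classes[OF F(1) cls])
    also have "\<dots> \<le> (\<Sum>y\<in>Sigma {..L} (\<lambda>l. {1..N} \<rightarrow>\<^sub>E {..l + 1}). C1 * K * x ^ fst y)"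
    proof (rule sum_mono2)
      show "finite (Sigma {..L} (\<lambda>l. {1..N} \<rightarrow>\<^sub>E {..l + 1}))"
        by (intro finite_SigmaI finite_PiE) auto
      show "key ` F \<subseteq> Sigma {..L} (\<lambda>l. {1..N} \<rightarrow>\<^sub>E {..l + 1})"
        using km F(1) by (auto simp: key_def L_def intro!: Max_ge)
    qed (use C1 K x in auto)
    also have "\<dots> = (\<Sum>l\<le>L. \<Sum>\<kappa>\<in>{1..N} \<rightarrow>\<^sub>E {..l + 1}. C1 * K * x ^ l)"
      by (subst sum.Sigma) (auto intro!: finite_PiE simp: case_prod_unfold)
    also have "\<dots> = C1 * K * (\<Sum>l\<le>L. (real l + 2) ^ N * x ^ l)"
      by (simp add: card_PiE sum_distrib_left mult_ac add_ac)
    also have "\<dots> \<le> C1 * K * (\<Sum>m. (real m + 2) ^ N * x ^ m)"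
      using C1 K x by (intro mult_left_mono sum_le_suminf summable_poly_mult_power) auto
    finally show "sum ?f F \<le> C1 * (\<Sum>m. (real m + 2) ^ N * x ^ m) * K" by (simp add: mult_ac)
  qed
qed

text \<open>C is chosen before K and h, which expresses its dependence on the parameters only, and
  \<open>inj_on\<close> makes the \<xi> distinct points. Summability is asserted separately because
  \<open>infsum\<close> is 0 on a non-summable family.\<close>

theorem theorem4:
  fixes N :: nat and \<alpha> \<gamma> \<tau> :: real and \<beta> :: "nat \<Rightarrow> real" and \<xi> :: "nat \<Rightarrow> complex"
  assumes "\<alpha> \<ge> 0" and "\<gamma> \<ge> 0" and "\<And>j. j \<in> {1..N} \<Longrightarrow> \<beta> j \<ge> 0"
    and "\<And>j. j \<in> {1..N} \<Longrightarrow> norm (\<xi> j) = 1" and "inj_on \<xi> {1..N}"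
    and "0 < \<tau>" and "\<tau> < 1"
  shows "\<exists>C::real. \<forall>(K::real) (h :: complex \<Rightarrow> complex).
           h holomorphic_on ball 0 1 \<longrightarrow> h 0 = 1 \<longrightarrow>
           (\<forall>z\<in>ball 0 1. elog (norm (h z)) \<le> ereal (K * growth \<alpha> \<beta> \<gamma> \<xi> N z)) \<longrightarrow>
           (\<lambda>z. of_int (zorder h z) * zero_weight \<alpha> \<beta> \<gamma> \<xi> N \<tau> z)
             summable_on {z \<in> ball 0 1. h z = 0} \<and>
           (\<Sum>\<^sub>\<infinity>z\<in>{z \<in> ball 0 1. h z = 0}. of_int (zorder h z) * zero_weight \<alpha> \<beta> \<gamma> \<xi> N \<tau> z)
             \<le> C * K"
proof -
  obtain A where A: "\<And>K h F. K \<ge> 0 \<Longrightarrow> h holomorphic_on ball 0 1 \<Longrightarrow> h 0 = 1 \<Longrightarrow>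
    (\<forall>z\<in>ball 0 1. elog (norm (h z)) \<le> ereal (K * growth \<alpha> \<beta> \<gamma> \<xi> N z)) \<Longrightarrow>
    finite F \<Longrightarrow> (\<forall>a\<in>F. norm a \<le> 1 / 4 \<and> h a = 0) \<Longrightarrow>
    (\<Sum>a\<in>F. nat (zorder h a) * zero_weight \<alpha> \<beta> \<gamma> \<xi> N \<tau> a) \<le> A * K"
    using sum_near_origin_le[of \<alpha> \<gamma> N \<beta> \<xi> \<tau>] assms by blast
  obtain B where B: "\<And>K h F. K \<ge> 0 \<Longrightarrow> h holomorphic_on ball 0 1 \<Longrightarrow> h 0 = 1 \<Longrightarrow>
    (\<forall>z\<in>ball 0 1. elog (norm (h z)) \<le> ereal (K * growth \<alpha> \<beta> \<gamma> \<xi> N z)) \<Longrightarrow>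
    finite F \<Longrightarrow> (\<forall>a\<in>F. 1 / 4 \<le> norm a \<and> norm a < 1 \<and> h a = 0) \<Longrightarrow>
    (\<Sum>a\<in>F. nat (zorder h a) * zero_weight \<alpha> \<beta> \<gamma> \<xi> N \<tau> a) \<le> B * K"
    using sum_away_from_origin_le[of \<alpha> \<gamma> N \<beta> \<xi> \<tau>] assms by blast
  show ?thesis
  proof (intro exI[of _ "A + B"] allI impI)
    fix K :: real and h :: "complex \<Rightarrow> complex"
    assume h: "h holomorphic_on ball 0 1" "h 0 = 1"
      and bd: "\<forall>z\<in>ball 0 1. elog (norm (h z)) \<le> ereal (K * growth \<alpha> \<beta> \<gamma> \<xi> N z)"
    let ?Z = "{z \<in> ball 0 1. h z = 0}"
    let ?f = "\<lambda>z. of_int (zorder h z) * zero_weight \<alpha> \<beta> \<gamma> \<xi> N \<tau> z"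
    \<comment> \<open>K is an arbitrary real in the statement; its sign follows from h 0 =
      1.\<close>
    have K: "K \<ge> 0"
      using growth_bound_nonneg[of N \<beta> \<xi> h K \<alpha> \<gamma>] assms h bd by blast
    have pos: "zorder h z > 0" if "z \<in> ?Z" for z
    proof -
      have "z \<in> ball 0 1" "\<exists>w\<in>ball 0 1. h w \<noteq> 0"
        using that h(2) by (auto intro!: bexI[of _ 0])
      from zorder_exist_zero[OF h(1) open_ball connected_ball this] that show ?thesis by simp
    qed
    have wt: "zero_weight \<alpha> \<beta> \<gamma> \<xi> N \<tau> z \<ge> 0" for z
      unfolding zero_weight_def by (intro mult_nonneg_nonneg divide_nonneg_nonneg prod_nonneg) auto
    have fin: "sum ?f F \<le> (A + B) * K" if F: "finite F" "F \<subseteq> ?Z" for F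
    proof -
      let ?g = "\<lambda>a. nat (zorder h a) * zero_weight \<alpha> \<beta> \<gamma> \<xi> N \<tau> a"
      \<comment> \<open>At zeros the order is positive, so passing through \<open>nat\<close>
        changes nothing.\<close>
      have "sum ?f F = sum ?g F"
        using F pos by (intro sum.cong) (force simp: less_imp_le)+
      also have "\<dots> = sum ?g {a \<in> F. norm a \<le> 1 / 4} + sum ?g {a \<in> F. \<not> norm a \<le> 1 / 4}"
        using F(1) by (subst sum.union_disjoint[symmetric]) (auto intro!: sum.cong)
      also have "\<dots> \<le> A * K + B * K"
        using F by (intro add_mono A[OF K h bd] B[OF K h bd]) auto
      finally show ?thesis by (simp add: algebra_simps)
    qed
    \<comment> \<open>The terms are nonnegative, so the uniform bound on finite partial sums gives
      both summability and the bound on the infinite sum.\<close>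
    have "?f summable_on ?Z"
    proof (rule nonneg_bdd_above_summable_on)
      show "?f z \<ge> 0" if "z \<in> ?Z" for z using pos[OF that] wt by simp
      show "bdd_above (sum ?f ` {F. F \<subseteq> ?Z \<and> finite F})"
        using fin by (intro bdd_aboveI[of _ "(A + B) * K"]) auto
    qed
    then show "?f summable_on ?Z \<and> infsum ?f ?Z \<le> (A + B) * K"
      using infsum_le_finite_sums fin by blast
  qed
qed

end
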